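(* Let $K$ be an algebraically closed field of arbitrary characteristic and let $f\in\mathfrak m\subset K[[x,y]]$ be reduced, with $r$ irreducible components (branches) $f_1,\dots,f_r$ and conductor ${\bf c}=(c_1,\dots,c_r)\in\mathbb Z_{\ge0}^r$. Define ${\bf d}\in\mathbb Z_{\ge 0}^r$ by $${\bf d}=\begin{cases}{\bf 1} & \text{if } \mathrm{mt}(f)=1,\\ {\bf c}+{\bf 1} & \text{if } \mathrm{mt}(f)=2 \text{ and } r=1,\\ {\bf c} & \text{if } \mathrm{mt}(f)=2 \text{ and } r=2,\\ {\bf c}-{\bf 1} & \text{if } \mathrm{mt}(f)>2,\end{cases}$$ where ${\bf 1}=(1,\dots,1)$. Then $f$ is parametrization ${\bf d}$-determined. In particular, $f$ is always parametrization $({\bf c}+{\bf 1})$-determined.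
   Context: $\mathfrak m=(x,y)$ is the maximal ideal of $K[[x,y]]$. For reduced $f$, let $R=K[[x,y]]/\langle f\rangle$; its integral closure in its total ring of fractions is $\bar R\cong\bigoplus_{i=1}^r K[[t]]$ (one copy per branch). A parametrization of $f$ is the composition $\psi\colon K[[x,y]]\twoheadrightarrow R\hookrightarrow\bar R$ of the projection with a normalization map; it is an element of $J=\mathrm{Hom}_K(K[[x,y]],\bar R)$ (local $K$-algebra morphisms), identified with the tuple of pairs $(x_i(t),y_i(t))=(\psi_i(x),\psi_i(y))$, $i=1,\dots,r$. Two $\psi,\psi'\in J$ are left-right equivalent if there exist an automorphism $\phi$ of $\bar R$ (an $r$-tuple of $K$-algebra automorphisms of $K[[t]]$) and $\Phi\in\mathrm{Aut}_K(K[[x,y]])$ with $\Phi\circ\psi=\phi\circ\psi'$. The conductor ideal $\mathcal C=\{u\in R: u\bar R\subset R\}$ equals $(t^{c_1})\times\cdots\times(t^{c_r})$ in $\bar R$; ${\bf c}=(c_1,\dots,c_r)$ is the conductor of $f$. For ${\bf k}=(k_1,\dots,k_r)\in\mathbb Z_{\ge0}^r$, the ${\bf k}$-jet $j^{\bf k}\psi$ is the composition of $\psi$ with $\bar R\to\bigoplus_i K[[t]]/(t^{k_i+1})$. A parametrization $\psi$ (and $f$) is parametrization ${\bf k}$-determined if every $\psi'\in J$ with $j^{\bf k}\psi'=j^{\bf k}\psi$ is left-right equivalent to $\psi$. $\mathrm{mt}(f)$ is the largest $k$ with $f\in\mathfrak m^k$. *)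

theory Defs
  imports "HOL-Computational_Algebra.Computational_Algebra"
begin

text \<open>K[[x,y]] is modelled as 'k fps fps (power series in y with coefficients
  power series in x); coefficient of x^i y^j:\<close>
definition coeff2 :: "'k::comm_ring_1 fps fps \<Rightarrow> nat \<Rightarrow> nat \<Rightarrow> 'k" where
  "coeff2 g i j = fps_nth (fps_nth g j) i"

definition in_mpow :: "'k::comm_ring_1 fps fps \<Rightarrow> nat \<Rightarrow> bool" where
  "in_mpow g k \<longleftrightarrow> (\<forall>i j. i + j < k \<longrightarrow> coeff2 g i j = 0)"

definition mt :: "'k::comm_ring_1 fps fps \<Rightarrow> nat" where
  "mt g = (GREATEST k. in_mpow g k)"

text \<open>Substitution g(a(t),b(t)) for a, b without constant term.\<close>
definition subst2 :: "'k::comm_ring_1 fps fps \<Rightarrow> 'k fps \<Rightarrow> 'k fps \<Rightarrow> 'k fps" where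
  "subst2 g a b = Abs_fps (\<lambda>n. \<Sum>i\<le>n. \<Sum>j\<le>n. coeff2 g i j * fps_nth (a ^ i * b ^ j) n)"

text \<open>Substitution g(X(x,y),Y(x,y)) for X, Y without constant term.\<close>
definition subst22 :: "'k::comm_ring_1 fps fps \<Rightarrow> 'k fps fps \<Rightarrow> 'k fps fps \<Rightarrow> 'k fps fps" where
  "subst22 g X Y = Abs_fps (\<lambda>q. Abs_fps (\<lambda>p.
      \<Sum>i\<le>p+q. \<Sum>j\<le>p+q. coeff2 g i j * coeff2 (X ^ i * Y ^ j) p q))"

text \<open>An element of J with r branches: the tuple of pairs (x_i(t), y_i(t)), i<r.
  Elements of \<open>\<Oplus>_{i<r} K[[t]]\<close> are functions nat => 'k fps, only indices i<r matter.\<close>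
type_synonym 'k param = "nat \<Rightarrow> 'k fps \<times> 'k fps"

definition psi :: "'k::comm_ring_1 param \<Rightarrow> 'k fps fps \<Rightarrow> nat \<Rightarrow> 'k fps" where
  "psi p g i = subst2 g (fst (p i)) (snd (p i))"

definition in_J :: "nat \<Rightarrow> 'k::comm_ring_1 param \<Rightarrow> bool" where
  "in_J r p \<longleftrightarrow> (\<forall>i<r. fps_nth (fst (p i)) 0 = 0 \<and> fps_nth (snd (p i)) 0 = 0)"

definition in_image :: "nat \<Rightarrow> 'k::comm_ring_1 param \<Rightarrow> (nat \<Rightarrow> 'k fps) \<Rightarrow> bool" where
  "in_image r p e \<longleftrightarrow> (\<exists>g. \<forall>i<r. e i = psi p g i)"

definition nonzerodiv_image :: "nat \<Rightarrow> 'k::comm_ring_1 param \<Rightarrow> (nat \<Rightarrow> 'k fps) \<Rightarrow> bool" where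
  "nonzerodiv_image r p b \<longleftrightarrow>
     (\<forall>s. in_image r p s \<longrightarrow> (\<forall>i<r. b i * s i = 0) \<longrightarrow> (\<forall>i<r. s i = 0))"

definition integral_over_image :: "nat \<Rightarrow> 'k::comm_ring_1 param \<Rightarrow> (nat \<Rightarrow> 'k fps) \<Rightarrow> bool" where
  "integral_over_image r p e \<longleftrightarrow>
     (\<exists>n s. (\<forall>k<n. in_image r p (s k)) \<and>
            (\<forall>i<r. e i ^ n + (\<Sum>k<n. s k i * e i ^ k) = 0))"

text \<open>p is a parametrization of f: psi is a local K-algebra morphism with kernel (f),
  and Rbar is the integral closure of R = psi(K[[x,y]]) in its total ring of fractions,
  i.e. every element of Rbar is integral over R and is a fraction a/b with a, b in R,
  b a non-zero-divisor of R.\<close>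
definition is_parametrization :: "'k::comm_ring_1 fps fps \<Rightarrow> nat \<Rightarrow> 'k param \<Rightarrow> bool" where
  "is_parametrization f r p \<longleftrightarrow>
     in_J r p \<and>
     (\<forall>g. (\<forall>i<r. psi p g i = 0) \<longleftrightarrow> f dvd g) \<and>
     (\<forall>e. integral_over_image r p e \<and>
          (\<exists>a b. in_image r p a \<and> in_image r p b \<and> nonzerodiv_image r p b \<and>
                 (\<forall>i<r. b i * e i = a i)))"

definition conductor :: "nat \<Rightarrow> 'k::comm_ring_1 param \<Rightarrow> (nat \<Rightarrow> nat) \<Rightarrow> bool" where
  "conductor r p c \<longleftrightarrow>
     (\<forall>u. (in_image r p u \<and> (\<forall>e. in_image r p (\<lambda>i. u i * e i))) \<longleftrightarrow>
          (\<forall>i<r. \<forall>n<c i. fps_nth (u i) n = 0))"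

definition same_jet :: "nat \<Rightarrow> (nat \<Rightarrow> nat) \<Rightarrow> 'k::comm_ring_1 param \<Rightarrow> 'k param \<Rightarrow> bool" where
  "same_jet r k p p' \<longleftrightarrow>
     (\<forall>g. \<forall>i<r. \<forall>n\<le>k i. fps_nth (psi p' g i) n = fps_nth (psi p g i) n)"

text \<open>K-algebra automorphisms of K[[t]] (h \<mapsto> h(u(t))) and of K[[x,y]] (g \<mapsto> g(X,Y)).\<close>
definition aut1 :: "'k::comm_ring_1 fps \<Rightarrow> bool" where
  "aut1 u \<longleftrightarrow> fps_nth u 0 = 0 \<and> bij (\<lambda>h. fps_compose h u)"

definition aut2 :: "'k::comm_ring_1 fps fps \<Rightarrow> 'k fps fps \<Rightarrow> bool" where
  "aut2 X Y \<longleftrightarrow> coeff2 X 0 0 = 0 \<and> coeff2 Y 0 0 = 0 \<and> bij (\<lambda>g. subst22 g X Y)"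

definition lr_equiv :: "nat \<Rightarrow> 'k::comm_ring_1 param \<Rightarrow> 'k param \<Rightarrow> bool" where
  "lr_equiv r p p' \<longleftrightarrow>
     (\<exists>X Y u. aut2 X Y \<and> (\<forall>i<r. aut1 (u i)) \<and>
        (\<forall>g. \<forall>i<r. psi p (subst22 g X Y) i = fps_compose (psi p' g i) (u i)))"

definition param_determined :: "nat \<Rightarrow> (nat \<Rightarrow> nat) \<Rightarrow> 'k::comm_ring_1 param \<Rightarrow> bool" where
  "param_determined r k p \<longleftrightarrow>
     (\<forall>p'. in_J r p' \<and> same_jet r k p p' \<longrightarrow> lr_equiv r p p')"

definition num_branches :: "'k::comm_ring_1 fps fps \<Rightarrow> nat \<Rightarrow> bool" where
  "num_branches f r \<longleftrightarrow>
     (\<exists>(fs :: 'k fps fps list) u. length fs = r \<and> (\<forall>g\<in>set fs. irreducible g) \<and>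
        (\<forall>i<r. \<forall>j<r. i \<noteq> j \<longrightarrow> \<not> fs ! i dvd fs ! j) \<and>
        u dvd 1 \<and> f = u * prod_list fs)"

end

theory Submission
  imports Defs
begin

text \<open>
  If every element of \<open>\<Oplus> K[[t]]\<close> vanishing to order \<open>k\<^sub>i + 1\<close> on each branch is \<open>\<psi>(a)\<close> with
  \<open>a \<in> \<mm>\<^sup>2\<close>, then a parametrization \<open>\<psi>'\<close> with the same \<open>k\<close>-jet is \<open>\<psi>\<close> composed with an
  automorphism \<open>x \<mapsto> x + a\<close>, \<open>y \<mapsto> y + b\<close>; no reparametrization of the branches is needed.

  Let \<open>m\<^sub>i\<close> be the multiplicity of the \<open>i\<close>-th branch and \<open>C = (t^c)\<close> the conductor. Comparing the
  growth of \<open>dim R/\<mm>\<^sup>n\<close> with that of \<open>\<Oplus> K[[t]]/(t^(n m\<^sub>i))\<close> gives \<open>mt(f) = \<Sum>m\<^sub>i\<close>. If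
  \<open>mt(f) > 2\<close>, then \<open>C\<close> needs \<open>mt(f) > 2\<close> generators over \<open>R\<close>, while an ideal of \<open>K[[x,y]]\<close> containing
  a series of order at most one has two generators; so \<open>C \<subseteq> \<psi>(\<mm>\<^sup>2)\<close>. If \<open>mt(f) \<le> 2\<close>, one uses
  \<open>(t^(c+m)) = \<mm>C \<subseteq> \<psi>(\<mm>\<^sup>2)\<close>, unless \<open>R\<close> is already normal.
\<close>

section \<open>Substitution in power series in two variables\<close>

lemma fps2_eqI:
  fixes g h :: "'a::comm_ring_1 fps fps"
  shows "(\<And>p q. coeff2 g p q = coeff2 h p q) \<Longrightarrow> g = h"
  by (simp add: fps_eq_iff coeff2_def)

lemma coeff2_simps [simp]:
  fixes g h :: "'a::comm_ring_1 fps fps"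
  shows "coeff2 (g + h) p q = coeff2 g p q + coeff2 h p q"
    and "coeff2 (g - h) p q = coeff2 g p q - coeff2 h p q"
    and "coeff2 (- g) p q = - coeff2 g p q"
    and "coeff2 (0 :: 'a fps fps) p q = 0"
    and "coeff2 (1 :: 'a fps fps) p q = (if p = 0 \<and> q = 0 then 1 else 0)"
  by (auto simp: coeff2_def)

lemma coeff2_sum [simp]:
  fixes g :: "'b \<Rightarrow> 'a::comm_ring_1 fps fps"
  shows "coeff2 (\<Sum>s\<in>S. g s) p q = (\<Sum>s\<in>S. coeff2 (g s) p q)"
  by (simp add: coeff2_def fps_sum_nth)

lemma coeff2_mult:
  fixes g h :: "'a::comm_ring_1 fps fps"
  shows "coeff2 (g * h) p q = (\<Sum>i\<le>p. \<Sum>j\<le>q. coeff2 g i j * coeff2 h (p - i) (q - j))"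
proof -
  have "coeff2 (g * h) p q = (\<Sum>j\<le>q. \<Sum>i\<le>p. coeff2 g i j * coeff2 h (p - i) (q - j))"
    by (simp add: coeff2_def fps_mult_nth fps_sum_nth atLeast0AtMost)
  then show ?thesis
    by (subst sum.swap) simp
qed

text \<open>The inner variable x is \<open>fps_const fps_X\<close>, the outer variable y is
  \<open>fps_X\<close>, and scalars carry \<open>fps_const\<close> twice.\<close>

definition mono2 :: "'a::comm_ring_1 \<Rightarrow> nat \<Rightarrow> nat \<Rightarrow> 'a fps fps" where
  "mono2 c i j = fps_const (fps_const c) * (fps_const fps_X ^ i * fps_X ^ j)"

lemma fps_const_power_X: "(fps_const u) ^ n = fps_const ((u::'a::comm_ring_1) ^ n)"
  by (induction n) auto

lemma coeff2_mono2 [simp]: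
  "coeff2 (mono2 c i j :: 'a::comm_ring_1 fps fps) p q = (if p = i \<and> q = j then c else 0)"
  by (auto simp: coeff2_def mono2_def fps_const_power_X mult.assoc[symmetric] fps_const_mult
      fps_mult_fps_X_power_commute[symmetric] fps_X_power_mult_nth
      simp del: fps_const_power)

lemma coeff2_const_mult [simp]:
  "coeff2 (fps_const (fps_const c) * g) p q = (c :: 'a::comm_ring_1) * coeff2 g p q"
  by (simp add: coeff2_def)

lemma mono2_mult: "mono2 c i j * mono2 d k l = mono2 (c * d :: 'a::comm_ring_1) (i + k) (j + l)"
  by (simp add: mono2_def power_add fps_const_mult[symmetric] algebra_simps del: fps_const_mult)

lemma in_mpowD: "in_mpow g n \<Longrightarrow> i + j < n \<Longrightarrow> coeff2 g i j = 0"
  by (simp add: in_mpow_def)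

lemma in_mpow_0 [simp]: "in_mpow g 0" "in_mpow 0 n"
  by (auto simp: in_mpow_def)

lemma in_mpow_1: "in_mpow g (Suc 0) \<longleftrightarrow> coeff2 g 0 0 = 0"
  by (auto simp: in_mpow_def)

lemma in_mpow_mono: "in_mpow g n \<Longrightarrow> m \<le> n \<Longrightarrow> in_mpow g m"
  by (auto simp: in_mpow_def)

lemma in_mpow_add: "in_mpow g n \<Longrightarrow> in_mpow h n \<Longrightarrow> in_mpow (g + h) n"
  by (auto simp: in_mpow_def)

lemma in_mpow_diff: "in_mpow g n \<Longrightarrow> in_mpow h n \<Longrightarrow> in_mpow (g - h) n"
  by (auto simp: in_mpow_def)

lemma in_mpow_mult:
  assumes "in_mpow g m" "in_mpow h n"
  shows "in_mpow (g * h) (m + n)"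
  unfolding in_mpow_def coeff2_mult
proof (intro allI impI sum.neutral ballI)
  fix p q i j assume "p + q < m + n" "i \<in> {..p}" "j \<in> {..q}"
  then have "i + j < m \<or> (p - i) + (q - j) < n"
    by auto
  then show "coeff2 g i j * coeff2 h (p - i) (q - j) = 0"
    using assms by (auto simp: in_mpow_def)
qed

lemma in_mpow_power: "in_mpow g m \<Longrightarrow> in_mpow (g ^ n) (n * m)"
  by (induction n) (auto intro: in_mpow_mult)

lemma in_mpow_monomial:
  assumes "in_mpow X (Suc 0)" "in_mpow Y (Suc 0)"
  shows "in_mpow (X ^ i * Y ^ j) (i + j)"
  using in_mpow_mult[OF in_mpow_power[OF assms(1), of i] in_mpow_power[OF assms(2), of j]] by simp

lemma in_mpow_all_eq_0: "(\<And>n. in_mpow g n) \<Longrightarrow> g = 0"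
  by (rule fps2_eqI) (metis coeff2_simps(4) in_mpowD lessI)

section \<open>Substitution as a continuous algebra endomorphism\<close>

lemma coeff2_subst22:
  assumes X: "in_mpow X (Suc 0)" and Y: "in_mpow Y (Suc 0)" and N: "p + q \<le> N"
  shows "coeff2 (subst22 g X Y) p q =
    (\<Sum>i\<le>N. \<Sum>j\<le>N. coeff2 g i j * coeff2 (X ^ i * Y ^ j) p q)"
proof -
  let ?t = "\<lambda>i j. coeff2 g i j * coeff2 (X ^ i * Y ^ j) p q"
  \<comment> \<open>X^i Y^j lies in m^(i+j), so every N >= p + q gives the same sum; N can then be
    taken large enough to reach a given monomial.\<close>
  have z: "?t i j = 0" if "p + q < i + j" for i j
    using in_mpowD[OF in_mpow_monomial[OF X Y] that] by simp
  have "(\<Sum>i\<le>N. \<Sum>j\<le>N. ?t i j) = (\<Sum>i\<le>N. \<Sum>j\<le>p + q. ?t i j)"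
    using N by (intro sum.cong refl sum.mono_neutral_right) (auto intro!: z)
  also have "\<dots> = (\<Sum>i\<le>p + q. \<Sum>j\<le>p + q. ?t i j)"
    using N by (intro sum.mono_neutral_right) (auto intro!: z sum.neutral)
  finally show ?thesis
    by (simp add: subst22_def coeff2_def)
qed

lemma subst22_add: "subst22 (g + h) X Y = subst22 g X Y + subst22 h X Y"
  by (rule fps2_eqI) (simp add: subst22_def coeff2_def sum.distrib distrib_right)

lemma subst22_diff: "subst22 (g - h) X Y = subst22 g X Y - subst22 h X Y"
  by (rule fps2_eqI) (simp add: subst22_def coeff2_def sum_subtractf left_diff_distrib)

lemma subst22_in_mpow:
  assumes "in_mpow X (Suc 0)" "in_mpow Y (Suc 0)" "in_mpow g n"
  shows "in_mpow (subst22 g X Y) n"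
  unfolding in_mpow_def
proof (intro allI impI)
  fix p q assume pq: "p + q < n"
  show "coeff2 (subst22 g X Y) p q = 0"
    unfolding coeff2_subst22[OF assms(1,2) order_refl]
  proof (intro sum.neutral ballI)
    fix i j
    have "coeff2 g i j = 0 \<or> coeff2 (X ^ i * Y ^ j) p q = 0"
      using in_mpowD[OF assms(3), of i j] in_mpowD[OF in_mpow_monomial[OF assms(1,2)], of p q i j] pq
      by linarith
    then show "coeff2 g i j * coeff2 (X ^ i * Y ^ j) p q = 0" by auto
  qed
qed

lemma subst22_mono2:
  assumes "in_mpow X (Suc 0)" "in_mpow Y (Suc 0)"
  shows "subst22 (mono2 c k l) X Y = fps_const (fps_const c) * (X ^ k * Y ^ l)"
proof (rule fps2_eqI)
  fix p q
  let ?N = "p + q + k + l"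
  have "coeff2 (subst22 (mono2 c k l) X Y) p q =
    (\<Sum>i\<le>?N. \<Sum>j\<le>?N. if k = i then (if l = j then c * coeff2 (X ^ i * Y ^ j) p q else 0) else 0)"
    by (subst coeff2_subst22[OF assms, of _ _ ?N]) (auto intro!: sum.cong)
  also have "\<dots> = (\<Sum>i\<le>?N. if k = i then (\<Sum>j\<le>?N. if l = j then c * coeff2 (X ^ i * Y ^ j) p q else 0) else 0)"
    by (intro sum.cong) auto
  also have "\<dots> = c * coeff2 (X ^ k * Y ^ l) p q"
    by simp
  finally show "coeff2 (subst22 (mono2 c k l) X Y) p q = coeff2 (fps_const (fps_const c) * (X ^ k * Y ^ l)) p q"
    by simp
qed

text \<open>Polynomials are dense for the \<open>\<mm>\<close>-adic topology.\<close>
lemma additive_filtered_eq: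
  fixes L M :: "'a::comm_ring_1 fps fps \<Rightarrow> 'a fps fps"
  assumes L: "\<And>g h. L (g + h) = L g + L h" "\<And>g n. in_mpow g n \<Longrightarrow> in_mpow (L g) n"
    and M: "\<And>g h. M (g + h) = M g + M h" "\<And>g n. in_mpow g n \<Longrightarrow> in_mpow (M g) n"
    and eq: "\<And>c i j. L (mono2 c i j) = M (mono2 c i j)"
  shows "L g = M g"
proof (rule fps2_eqI)
  fix p q
  define n where "n = Suc (p + q)"
  define g' where "g' = (\<Sum>(i,j)\<in>{..<n}\<times>{..<n}. mono2 (coeff2 g i j) i j)"
  have sum: "L (\<Sum>s\<in>S. u s) = M (\<Sum>s\<in>S. u s)"
    if "\<And>s. s \<in> S \<Longrightarrow> L (u s) = M (u s)" for S :: "(nat \<times> nat) set" and u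
    using that
  proof (induction S rule: infinite_finite_induct)
    case (insert x F)
    then show ?case by (simp add: L M)
  qed (use L(1)[of 0 0] M(1)[of 0 0] in auto)
  have g': "L g' = M g'"
    unfolding g'_def by (rule sum) (auto simp: eq)
  have "coeff2 g' i j = coeff2 g i j" if "i + j < n" for i j
  proof -
    have "coeff2 g' i j = (\<Sum>s\<in>{..<n}\<times>{..<n}. if (i, j) = s then coeff2 g i j else 0)"
      unfolding g'_def coeff2_sum by (intro sum.cong) (auto split: prod.split)
    also have "\<dots> = coeff2 g i j"
      using that by simp
    finally show ?thesis .
  qed
  then have n: "in_mpow (g - g') n"
    by (simp add: in_mpow_def)
  have "coeff2 (L (g - g')) p q = 0" "coeff2 (M (g - g')) p q = 0"
    using L(2)[OF n] M(2)[OF n] by (auto simp: in_mpow_def n_def)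
  moreover have "L g = L (g - g') + L g'" "M g = M (g - g') + M g'"
    by (simp_all flip: L(1) M(1))
  ultimately show "coeff2 (L g) p q = coeff2 (M g) p q"
    using g' by simp
qed

lemma mult_in_mpow:
  assumes "in_mpow g n"
  shows "in_mpow (g * h) n" "in_mpow (h * g) n"
  using in_mpow_mult[OF assms in_mpow_0(1)[of h]] by (auto simp: mult.commute)

text \<open>Density is applied in h for a monomial g, then in g for arbitrary h; only products of
  two monomials remain.\<close>

lemma subst22_mult:
  assumes "in_mpow X (Suc 0)" "in_mpow Y (Suc 0)"
  shows "subst22 (g * h) X Y = subst22 g X Y * subst22 h X Y"
proof -
  have mono: "subst22 (mono2 c i j * mono2 d k l) X Y = subst22 (mono2 c i j) X Y * subst22 (mono2 d k l) X Y"
    for c d i j k l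
    by (simp add: mono2_mult subst22_mono2[OF assms] power_add fps_const_mult[symmetric] ac_simps
        del: fps_const_mult)
  have *: "subst22 (mono2 c i j * h) X Y = subst22 (mono2 c i j) X Y * subst22 h X Y" for c i j
    by (rule additive_filtered_eq[of "\<lambda>h. subst22 (mono2 c i j * h) X Y"
          "\<lambda>h. subst22 (mono2 c i j) X Y * subst22 h X Y"])
      (use assms mono in \<open>auto simp: subst22_add distrib_left
          intro!: subst22_in_mpow mult_in_mpow(2)\<close>)
  show ?thesis
    by (rule additive_filtered_eq[of "\<lambda>g. subst22 (g * h) X Y"
          "\<lambda>g. subst22 g X Y * subst22 h X Y"])
      (use assms * in \<open>auto simp: subst22_add distrib_right intro!: subst22_in_mpow mult_in_mpow(1)\<close>)
qed

lemma subst22_const [simp]: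
  assumes "in_mpow X (Suc 0)" "in_mpow Y (Suc 0)"
  shows "subst22 (fps_const (fps_const c)) X Y = fps_const (fps_const c)"
  using subst22_mono2[OF assms, of c 0 0] by (simp add: mono2_def)

lemma subst22_one [simp]:
  assumes "in_mpow X (Suc 0)" "in_mpow Y (Suc 0)"
  shows "subst22 1 X Y = 1"
  using subst22_const[OF assms, of 1] by simp

lemma subst22_power:
  assumes "in_mpow X (Suc 0)" "in_mpow Y (Suc 0)"
  shows "subst22 (g ^ n) X Y = subst22 g X Y ^ n"
  by (induction n) (simp_all add: assms subst22_mult)

lemma subst22_vars:
  assumes "in_mpow X (Suc 0)" "in_mpow Y (Suc 0)"
  shows "subst22 (fps_const fps_X) X Y = X" "subst22 fps_X X Y = Y"
  using subst22_mono2[OF assms, of 1 1 0] subst22_mono2[OF assms, of 1 0 1] by (simp_all add: mono2_def)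

lemma in_mpow_vars: "in_mpow (fps_const fps_X) (Suc 0)" "in_mpow fps_X (Suc 0)"
  by (auto simp: in_mpow_def coeff2_def)

lemma subst22_id: "subst22 g (fps_const fps_X) fps_X = g"
  by (rule additive_filtered_eq[of "\<lambda>g. subst22 g (fps_const fps_X) fps_X" "\<lambda>g. g"])
    (auto simp: subst22_add subst22_mono2[OF in_mpow_vars, folded mono2_def]
      intro!: subst22_in_mpow in_mpow_vars)

lemma subst22_subst22:
  assumes "in_mpow X (Suc 0)" "in_mpow Y (Suc 0)" "in_mpow U (Suc 0)" "in_mpow V (Suc 0)"
  shows "subst22 (subst22 g X Y) U V = subst22 g (subst22 X U V) (subst22 Y U V)"
  by (rule additive_filtered_eq[of "\<lambda>g. subst22 (subst22 g X Y) U V"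
          "\<lambda>g. subst22 g (subst22 X U V) (subst22 Y U V)"])
    (use assms in \<open>auto simp: subst22_add subst22_mono2 subst22_in_mpow subst22_mult subst22_power\<close>)

text \<open>A change of variables tangent to the identity acts trivially on m^n/m^(n+1), because
  each x^i y^j changes only in degrees above i + j.\<close>

lemma subst22_unipotent:
  assumes a: "in_mpow a 2" and b: "in_mpow b 2" and g: "in_mpow g n"
  shows "in_mpow (subst22 g (fps_const fps_X + a) (fps_X + b) - g) (Suc n)"
proof -
  let ?X = "fps_const fps_X :: 'a fps fps"
  have X: "in_mpow (?X + a) (Suc 0)" "in_mpow (fps_X + b) (Suc 0)"
    by (auto intro!: in_mpow_add in_mpow_vars in_mpow_mono[OF a] in_mpow_mono[OF b])
  have dp: "in_mpow ((u + v) ^ i - u ^ i) (Suc i)"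
    if u: "in_mpow u (Suc 0)" and v: "in_mpow v 2" for u v :: "'a fps fps" and i
  proof (induction i)
    case (Suc i)
    have "(u + v) ^ Suc i - u ^ Suc i = (u + v) * ((u + v) ^ i - u ^ i) + v * u ^ i"
      by (simp add: algebra_simps)
    moreover have "in_mpow ((u + v) * ((u + v) ^ i - u ^ i)) (Suc 0 + Suc i)"
      by (intro in_mpow_mult Suc in_mpow_add u in_mpow_mono[OF v]) simp
    moreover have "in_mpow (v * u ^ i) (2 + i * Suc 0)"
      by (intro in_mpow_mult v in_mpow_power u)
    ultimately show ?case
      by (simp add: in_mpow_add)
  qed auto
  have dm: "in_mpow ((?X + a) ^ i * (fps_X + b) ^ j - ?X ^ i * fps_X ^ j) (Suc (i + j))" for i j
  proof -
    have "(?X + a) ^ i * (fps_X + b) ^ j - ?X ^ i * fps_X ^ j =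
      ((?X + a) ^ i - ?X ^ i) * (fps_X + b) ^ j + ?X ^ i * ((fps_X + b) ^ j - fps_X ^ j)"
      by (simp add: algebra_simps)
    moreover have "in_mpow (((?X + a) ^ i - ?X ^ i) * (fps_X + b) ^ j) (Suc i + j * Suc 0)"
      by (intro in_mpow_mult dp in_mpow_vars a in_mpow_power X)
    moreover have "in_mpow (?X ^ i * ((fps_X + b) ^ j - fps_X ^ j)) (i * Suc 0 + Suc j)"
      by (intro in_mpow_mult dp in_mpow_vars b in_mpow_power X)
    ultimately show ?thesis
      by (simp add: in_mpow_add)
  qed
  show ?thesis
    unfolding in_mpow_def
  proof (intro allI impI)
    fix p q assume pq: "p + q < Suc n"
    have "coeff2 (subst22 g (?X + a) (fps_X + b) - g) p q
        = coeff2 (subst22 g (?X + a) (fps_X + b)) p q - coeff2 (subst22 g ?X fps_X) p q"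
      by (simp add: subst22_id)
    also have "\<dots> = (\<Sum>i\<le>p+q. \<Sum>j\<le>p+q. coeff2 g i j *
        coeff2 ((?X + a) ^ i * (fps_X + b) ^ j - ?X ^ i * fps_X ^ j) p q)"
      by (simp add: coeff2_subst22[OF X order_refl] coeff2_subst22[OF in_mpow_vars order_refl]
          right_diff_distrib sum_subtractf)
    also have "\<dots> = 0"
    proof (intro sum.neutral ballI)
      fix i j
      have "coeff2 g i j = 0 \<or>
        coeff2 ((?X + a) ^ i * (fps_X + b) ^ j - ?X ^ i * fps_X ^ j) p q = 0"
        using in_mpowD[OF g, of i j] in_mpowD[OF dm, of p q i j] pq by linarith
      then show "coeff2 g i j *
        coeff2 ((?X + a) ^ i * (fps_X + b) ^ j - ?X ^ i * fps_X ^ j) p q = 0" by auto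
    qed
    finally show "coeff2 (subst22 g (?X + a) (fps_X + b) - g) p q = 0" .
  qed
qed

text \<open>Successive approximation: a kernel element in m^n lies in m^(n+1), and adding its own
  error to an approximate preimage raises the order of the error by one.\<close>

lemma bij_subst22_unipotent:
  assumes a: "in_mpow a 2" and b: "in_mpow b 2"
  shows "bij (\<lambda>g. subst22 g (fps_const fps_X + a) (fps_X + b :: 'a::comm_ring_1 fps fps))"
    (is "bij ?F")
proof (rule bijI)
  have X: "in_mpow (fps_const fps_X + a) (Suc 0)" "in_mpow (fps_X + b) (Suc 0)"
    by (auto intro!: in_mpow_add in_mpow_vars in_mpow_mono[OF a] in_mpow_mono[OF b])
  show "inj ?F"
  proof (rule injI)
    fix g h assume eq: "?F g = ?F h"
    have "in_mpow (g - h) n" for n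
    proof (induction n)
      case (Suc n)
      have "in_mpow (0 - (?F (g - h) - (g - h))) (Suc n)"
        by (intro in_mpow_diff subst22_unipotent a b Suc) simp
      then show ?case
        using eq by (simp add: subst22_diff)
    qed simp
    then show "g = h"
      using in_mpow_all_eq_0[of "g - h"] by simp
  qed
  show "surj ?F"
  proof (unfold surj_def, intro allI)
    fix h
    define s where "s = rec_nat 0 (\<lambda>_ g. g + (h - ?F g))"
    have s_Suc: "s (Suc n) = s n + (h - ?F (s n))" for n
      by (simp add: s_def)
    have res: "in_mpow (h - ?F (s n)) n" for n
    proof (induction n)
      case (Suc n)
      have "h - ?F (s (Suc n)) = 0 - (?F (h - ?F (s n)) - (h - ?F (s n)))"
        by (simp add: s_Suc subst22_add)
      also have "in_mpow \<dots> (Suc n)"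
        by (intro in_mpow_diff subst22_unipotent a b Suc) simp
      finally show ?case .
    qed simp
    have cau: "in_mpow (s (n + k) - s n) n" for n k
    proof (induction k)
      case (Suc k)
      have "s (n + Suc k) - s n = (s (n + k) - s n) + (h - ?F (s (n + k)))"
        by (simp add: s_Suc)
      also have "in_mpow \<dots> n"
        by (intro in_mpow_add Suc in_mpow_mono[OF res]) simp
      finally show ?case .
    qed simp
    \<comment> \<open>The coefficient at (p,q) is constant along \<open>s\<close> from index p + q +
      1 on.\<close>
    define g where "g = Abs_fps (\<lambda>q. Abs_fps (\<lambda>p. coeff2 (s (Suc (p + q))) p q))"
    have g: "in_mpow (g - s n) n" for n
      unfolding in_mpow_def
    proof (intro allI impI)
      fix p q assume "p + q < n"
      then have "coeff2 (s (Suc (p + q) + (n - Suc (p + q))) - s (Suc (p + q))) p q = 0"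
        by (intro in_mpowD[OF cau]) auto
      then show "coeff2 (g - s n) p q = 0"
        using \<open>p + q < n\<close> by (simp add: g_def coeff2_def)
    qed
    have "in_mpow (h - ?F g) n" for n
    proof -
      have "h - ?F g = (h - ?F (s n)) - ?F (g - s n)"
        by (simp add: subst22_diff)
      also have "in_mpow \<dots> n"
        by (intro in_mpow_diff res subst22_in_mpow X g)
      finally show ?thesis .
    qed
    then have "h - ?F g = 0"
      by (rule in_mpow_all_eq_0)
    then show "\<exists>g. h = ?F g"
      by auto
  qed
qed

text \<open>A formal inverse function argument: one of the variables completes a to a coordinate
  system, and a linear change reduces this to the unipotent case.\<close>

lemma surj_subst22_order_one:
  fixes a :: "'a::field fps fps"
  assumes a: "in_mpow a (Suc 0)" "\<not> in_mpow a 2"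
  shows "\<exists>b. in_mpow b (Suc 0) \<and> surj (\<lambda>g. subst22 g b a)"
proof -
  let ?X = "fps_const fps_X :: 'a fps fps" and ?C = "\<lambda>c. fps_const (fps_const c) :: 'a fps fps"
  define \<alpha> \<beta> where "\<alpha> = coeff2 a 1 0" and "\<beta> = coeff2 a 0 1"
  have co: "coeff2 ?X i j = (if i = 1 \<and> j = 0 then 1 else 0)"
      "coeff2 (fps_X :: 'a fps fps) i j = (if i = 0 \<and> j = 1 then 1 else 0)" for i j
    by (auto simp: coeff2_def)
  have two: "in_mpow g 2 \<longleftrightarrow> coeff2 g 0 0 = 0 \<and> coeff2 g 1 0 = 0 \<and> coeff2 g 0 1 = 0" for g :: "'a fps fps"
  proof -
    have "i + j < 2 \<longleftrightarrow> (i, j) = (0, 0) \<or> (i, j) = (1, 0) \<or> (i, j) = (0, 1)" for i j :: nat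
      by auto
    then show ?thesis
      unfolding in_mpow_def by auto
  qed
  have a0: "coeff2 a 0 0 = 0"
    using a by (simp add: in_mpow_1)
  \<comment> \<open>\<open>L1\<close> and \<open>L2\<close>, chosen below as linear forms, invert
    the linear part of the pair (b, a).\<close>
  have *: ?thesis if b: "in_mpow b (Suc 0)" and L: "in_mpow L1 (Suc 0)" "in_mpow L2 (Suc 0)"
    and L1: "in_mpow (subst22 L1 b a - ?X) 2" and L2: "in_mpow (subst22 L2 b a - fps_X) 2" for b L1 L2
  proof (intro exI[of _ b] conjI b)
    have "g \<in> range (\<lambda>g. subst22 g b a)" for g
    proof -
      obtain h where "g = subst22 h (?X + (subst22 L1 b a - ?X)) (fps_X + (subst22 L2 b a - fps_X))"
        using bij_subst22_unipotent[OF L1 L2] by (meson bij_pointE)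
      also have "\<dots> = subst22 (subst22 h L1 L2) b a"
        using b a L by (simp add: subst22_subst22)
      finally show ?thesis by auto
    qed
    then show "surj (\<lambda>g. subst22 g b a)" by auto
  qed
  have S: "subst22 (?C s * ?X + ?C t * fps_X) b a = ?C s * b + ?C t * a" if "in_mpow b (Suc 0)" for b s t
    using that a by (simp add: subst22_add subst22_mult subst22_vars del: fps_const_mult)
  have M: "in_mpow (?C s * ?X + ?C t * fps_X) (Suc 0)" for s t
    by (simp add: in_mpow_1 co del: fps_const_mult)
  show ?thesis
  proof (cases "\<beta> = 0")
    case False
    then show ?thesis
      by (intro *[of ?X "?C 1 * ?X + ?C 0 * fps_X" "?C (- \<alpha> / \<beta>) * ?X + ?C (1 / \<beta>) * fps_X"] M in_mpow_vars)
        (simp_all only: S[OF in_mpow_vars(1)], simp_all add: two co a0 \<alpha>_def \<beta>_def del: fps_const_mult)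
  next
    case True
    then have "\<alpha> \<noteq> 0"
      using a(2) a0 by (auto simp: two \<alpha>_def \<beta>_def)
    then show ?thesis using True
      by (intro *[of fps_X "?C (- \<beta> / \<alpha>) * ?X + ?C (1 / \<alpha>) * fps_X" "?C 1 * ?X + ?C 0 * fps_X"] M in_mpow_vars)
        (simp_all only: S[OF in_mpow_vars(2)], simp_all add: two co a0 \<alpha>_def \<beta>_def del: fps_const_mult)
  qed
qed

lemma fps2_unit: "(g :: 'a::field fps fps) dvd 1" if "coeff2 g 0 0 \<noteq> 0"
proof -
  have "inverse (fps_nth g 0) * fps_nth g 0 = 1"
    using that by (intro inverse_mult_eq_1) (simp add: coeff2_def)
  then have "g * fps_right_inverse g (inverse (fps_nth g 0)) = 1"
    by (intro fps_right_inverse) (simp add: mult.commute)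
  then show ?thesis
    by (metis dvd_triv_left)
qed

text \<open>Modulo a series of order at most one, an ideal of \<open>K[[x,y]]\<close> becomes an ideal of a
  discrete valuation ring (or is everything).\<close>
lemma ideal_order_one_two_generators:
  fixes I :: "'a::field fps fps set"
  assumes diff: "\<And>g h. g \<in> I \<Longrightarrow> h \<in> I \<Longrightarrow> g - h \<in> I"
    and mult: "\<And>g h. g \<in> I \<Longrightarrow> h * g \<in> I"
    and a: "a \<in> I" "\<not> in_mpow a 2"
  shows "\<exists>b\<in>I. \<forall>g\<in>I. \<exists>u v. g = u * a + v * b"
proof (cases "in_mpow a (Suc 0)")
  case False
  then have "a dvd g" for g
    using dvd_trans[OF fps2_unit one_dvd, of a] by (auto simp: in_mpow_1)
  then have "\<exists>u v. g = u * a + v * a" for g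
    by (metis add.right_neutral dvdE mult.commute mult_zero_left)
  then show ?thesis
    using a by blast
next
  case a1: True
  obtain b where b: "in_mpow b (Suc 0)" and surj: "surj (\<lambda>g. subst22 g b a)"
    using surj_subst22_order_one[OF a1 a(2)] by blast
  let ?\<phi> = "\<lambda>h. subst22 (fps_const h) b a"
  have phi_mult: "?\<phi> (h * h') = ?\<phi> h * ?\<phi> h'" for h h'
    using subst22_mult[OF b a1, of "fps_const h" "fps_const h'"] by simp
  \<comment> \<open>In the coordinates (b, a) every series is a series in b alone plus a multiple of
    a.\<close>
  have red: "\<exists>h q. g = ?\<phi> h + q * a" for g
  proof -
    obtain G where G: "g = subst22 G b a"
      using surj by (meson surjD)
    have "G = fps_const (fps_nth G 0) + fps_shift 1 G * fps_X"
      by (simp add: fps_eq_iff)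
    then have "subst22 G b a = ?\<phi> (fps_nth G 0) + subst22 (fps_shift 1 G) b a * a"
      by (metis subst22_add subst22_mult[OF b a1] subst22_vars(2)[OF b a1])
    then show ?thesis using G by blast
  qed
  have phi_I: "?\<phi> h \<in> I" if "g \<in> I" "g = ?\<phi> h + q * a" for g h q
    using diff[OF that(1) mult[OF a(1), of q]] that(2) by simp
  show ?thesis
  proof (cases "\<exists>h. ?\<phi> h \<in> I \<and> h \<noteq> 0")
    case False
    then have "\<exists>u v. g = u * a + v * a" if "g \<in> I" for g
      using red[of g] phi_I[OF that]
      by (metis (no_types, lifting) add.commute add.right_neutral fps_const_0_eq_0 mult_zero_left
          subst22_diff diff_self)
    then show ?thesis using a by blast
  next
    case True
    \<comment> \<open>A nonzero series of least order among those whose value at b lies in I divides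
      all the others.\<close>
    define n where "n = (LEAST n. \<exists>h. ?\<phi> h \<in> I \<and> h \<noteq> 0 \<and> subdegree h = n)"
    have "\<exists>h. ?\<phi> h \<in> I \<and> h \<noteq> 0 \<and> subdegree h = n"
      unfolding n_def by (rule LeastI_ex) (use True in blast)
    then obtain h0 where h0: "?\<phi> h0 \<in> I" "h0 \<noteq> 0" "subdegree h0 = n"
      by blast
    have dvd: "h0 dvd h" if "?\<phi> h \<in> I" for h
    proof (cases "h = 0")
      case False
      then have "n \<le> subdegree h"
        unfolding n_def by (intro Least_le) (use that in blast)
      then show ?thesis
        using h0 False by (simp add: fps_dvd_iff)
    qed simp
    show ?thesis
    proof (intro bexI[of _ "?\<phi> h0"] ballI)
      fix g assume "g \<in> I"
      obtain h q where g: "g = ?\<phi> h + q * a"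
        using red by blast
      obtain w where "h = h0 * w"
        using dvd phi_I[OF \<open>g \<in> I\<close> g] by (auto elim: dvdE)
      then have "g = q * a + ?\<phi> w * ?\<phi> h0"
        using g by (simp add: phi_mult mult.commute add.commute)
      then show "\<exists>u v. g = u * a + v * ?\<phi> h0" by blast
    qed (rule h0)
  qed
qed

lemma fps_const_inject: "fps_const a = fps_const b \<longleftrightarrow> a = (b :: 'a::zero)"
  by (metis fps_nth_fps_const)

section \<open>Parametrizations\<close>

text \<open>Through this embedding of \<open>K[[t]]\<close> into \<open>K[[x,y]]\<close> the algebra of \<open>subst22\<close> carries over to \<open>psi\<close>.\<close>
lemma fps_const_subst2: "fps_const (subst2 g a b) = subst22 g (fps_const a) (fps_const b)"
proof (rule fps2_eqI)
  fix p q
  have "coeff2 (fps_const a ^ i * fps_const b ^ j) p q = (if q = 0 then fps_nth (a ^ i * b ^ j) p else 0)" for i j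
    by (simp add: coeff2_def)
  then show "coeff2 (fps_const (subst2 g a b)) p q = coeff2 (subst22 g (fps_const a) (fps_const b)) p q"
    by (auto simp: coeff2_def subst2_def subst22_def)
qed

lemma in_mpow_fps_const: "in_mpow (fps_const a) (Suc 0) \<longleftrightarrow> fps_nth a 0 = 0"
  by (simp add: in_mpow_1 coeff2_def)

context
  fixes r :: nat and p :: "'a::comm_ring_1 param"
  assumes J: "in_J r p"
begin

lemma fps_const_psi: "fps_const (psi p g i) = subst22 g (fps_const (fst (p i))) (fps_const (snd (p i)))"
  by (simp add: psi_def fps_const_subst2)

lemma in_mpow_param:
  assumes "i < r"
  shows "in_mpow (fps_const (fst (p i))) (Suc 0)" "in_mpow (fps_const (snd (p i))) (Suc 0)"
  using J assms by (auto simp: in_J_def in_mpow_fps_const)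

lemma psi_add: "i < r \<Longrightarrow> psi p (g + h) i = psi p g i + psi p h i"
  and psi_diff: "i < r \<Longrightarrow> psi p (g - h) i = psi p g i - psi p h i"
  and psi_mult: "i < r \<Longrightarrow> psi p (g * h) i = psi p g i * psi p h i"
  and psi_power: "i < r \<Longrightarrow> psi p (g ^ n) i = psi p g i ^ n"
  and psi_const: "i < r \<Longrightarrow> psi p (fps_const (fps_const k)) i = fps_const k"
  and psi_vars: "i < r \<Longrightarrow> psi p (fps_const fps_X) i = fst (p i)" "i < r \<Longrightarrow> psi p fps_X i = snd (p i)"
  by (rule fps_const_inject[THEN iffD1], simp add: fps_const_psi in_mpow_param subst22_add subst22_diff
      subst22_mult subst22_power subst22_vars
      flip: fps_const_add fps_const_sub fps_const_mult fps_const_power)+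

lemma psi_zero: "i < r \<Longrightarrow> psi p 0 i = 0"
  using psi_diff[of i 0 0] by simp

lemma psi_sum: "i < r \<Longrightarrow> psi p (\<Sum>s\<in>S. g s) i = (\<Sum>s\<in>S. psi p (g s) i)"
  by (induction S rule: infinite_finite_induct) (auto simp: psi_add psi_zero)

text \<open>The common constant term on all branches reflects that the image is local; it later
  excludes idempotents separating two branches.\<close>

lemma psi_nth_0:
  assumes "i < r"
  shows "fps_nth (psi p g i) 0 = coeff2 g 0 0"
  using assms by (simp add: psi_def subst2_def)

end

section \<open>Vanishing orders along the branches, and the criterion for determinacy\<close>

lemma fps_X_power_dvd_iff: "fps_X ^ n dvd u \<longleftrightarrow> (\<forall>k<n. fps_nth (u :: 'a::comm_ring_1 fps) k = 0)"
proof
  assume "fps_X ^ n dvd u"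
  then show "\<forall>k<n. fps_nth u k = 0"
    by (auto simp: fps_X_power_mult_nth elim!: dvdE)
next
  assume *: "\<forall>k<n. fps_nth u k = 0"
  have "u = fps_X ^ n * fps_shift n u"
    using * by (auto simp: fps_eq_iff fps_X_power_mult_nth)
  then show "fps_X ^ n dvd u"
    by (metis dvd_triv_left)
qed

lemma psi_order:
  fixes p :: "'a::comm_ring_1 param"
  assumes g: "in_mpow g n" and "fps_X ^ m dvd fst (p i)" "fps_X ^ m dvd snd (p i)"
  shows "fps_X ^ (n * m) dvd psi p g i"
  unfolding fps_X_power_dvd_iff
proof (intro allI impI)
  fix k assume k: "k < n * m"
  have "fps_X ^ ((i' + j') * m) dvd fst (p i) ^ i' * snd (p i) ^ j'" for i' j'
    unfolding add_mult_distrib power_add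
    using assms by (metis mult.commute mult_dvd_mono dvd_power_same power_mult)
  then have *: "fps_nth (fst (p i) ^ i' * snd (p i) ^ j') k = 0" if "k < (i' + j') * m" for i' j'
    using that unfolding fps_X_power_dvd_iff by blast
  have "coeff2 g i' j' * fps_nth (fst (p i) ^ i' * snd (p i) ^ j') k = 0" for i' j'
  proof (cases "i' + j' < n")
    case True
    then show ?thesis by (simp add: in_mpowD[OF g])
  next
    case False
    then have "k < (i' + j') * m"
      using k by (meson leI less_le_trans mult_le_mono1)
    then show ?thesis by (simp add: *)
  qed
  then show "fps_nth (psi p g i) k = 0"
    by (simp add: psi_def subst2_def)
qed

text \<open>The jet condition for x and y makes the coordinates differ by elements that lift to a, b
  in m^2. The unipotent automorphism x + a, y + b then carries one parametrization to the
  other.\<close>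

lemma param_determined_if_msquare:
  fixes p :: "'a::field param"
  assumes J: "in_J r p"
    and sq: "\<And>u. (\<And>i. i < r \<Longrightarrow> fps_X ^ Suc (k i) dvd u i) \<Longrightarrow> \<exists>a. in_mpow a 2 \<and> (\<forall>i<r. psi p a i = u i)"
  shows "param_determined r k p"
  unfolding param_determined_def
proof (intro allI impI, elim conjE)
  fix p' assume J': "in_J r p'" and jet: "same_jet r k p p'"
  have d: "fps_X ^ Suc (k i) dvd psi p' g i - psi p g i" if "i < r" for g i
    using jet that unfolding fps_X_power_dvd_iff same_jet_def by auto
  obtain a where a: "in_mpow a 2" "\<And>i. i < r \<Longrightarrow> psi p a i = fst (p' i) - fst (p i)"
    using sq[of "\<lambda>i. fst (p' i) - fst (p i)"] d[of _ "fps_const fps_X"]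
    by (auto simp: psi_vars[OF J] psi_vars[OF J'])
  obtain b where b: "in_mpow b 2" "\<And>i. i < r \<Longrightarrow> psi p b i = snd (p' i) - snd (p i)"
    using sq[of "\<lambda>i. snd (p' i) - snd (p i)"] d[of _ "fps_X"]
    by (auto simp: psi_vars[OF J] psi_vars[OF J'])
  let ?X = "fps_const fps_X + a" and ?Y = "fps_X + b"
  have X: "in_mpow ?X (Suc 0)" "in_mpow ?Y (Suc 0)"
    by (auto intro!: in_mpow_add in_mpow_vars in_mpow_mono[OF a(1)] in_mpow_mono[OF b(1)])
  have "psi p (subst22 g ?X ?Y) i = psi p' g i" if i: "i < r" for g i
  proof -
    have "fps_const (psi p (subst22 g ?X ?Y) i) =
        subst22 g (fps_const (psi p ?X i)) (fps_const (psi p ?Y i))"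
      using i by (simp add: fps_const_psi[OF J] subst22_subst22 X in_mpow_param[OF J])
    also have "\<dots> = subst22 g (fps_const (fst (p' i))) (fps_const (snd (p' i)))"
      using i by (simp add: psi_add[OF J] psi_vars[OF J] a b)
    finally show ?thesis
      by (simp add: psi_def fps_const_inject flip: fps_const_subst2)
  qed
  moreover have "aut2 ?X ?Y"
    using X bij_subst22_unipotent[OF a(1) b(1)] by (simp add: aut2_def in_mpow_1)
  moreover have "aut1 (fps_X :: 'a fps)"
    by (simp add: aut1_def bij_id[unfolded id_def])
  ultimately show "lr_equiv r p p'"
    unfolding lr_equiv_def
    by (intro exI[of _ ?X] exI[of _ ?Y] exI[of _ "\<lambda>_. fps_X"]) simp
qed

section \<open>Linear systems and leading monomials\<close>

text \<open>Gaussian elimination, one equation per induction step.\<close>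

lemma homogeneous_system_nontrivial_solution:
  fixes A :: "'e \<Rightarrow> 's \<Rightarrow> 'a::field"
  assumes "finite E" "finite S" "card E < card S"
  shows "\<exists>x. (\<exists>s\<in>S. x s \<noteq> 0) \<and> (\<forall>e\<in>E. (\<Sum>s\<in>S. A e s * x s) = 0)"
  using assms
proof (induction E arbitrary: S A rule: finite_induct)
  case empty
  then obtain s where "s \<in> S" by fastforce
  then show ?case by (intro exI[of _ "\<lambda>_. 1"]) auto
next
  case (insert e E)
  show ?case
  proof (cases "\<forall>s\<in>S. A e s = 0")
    case True
    have "card E < card S" using insert by simp
    from insert.IH[OF insert.prems(1) this, of A] show ?thesis
      using True by auto
  next
    case False
    then obtain s0 where s0: "s0 \<in> S" "A e s0 \<noteq> 0" by blast
    define S' where "S' = S - {s0}"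
    have S: "S = insert s0 S'" "s0 \<notin> S'" "finite S'"
      using s0 insert by (auto simp: S'_def)
    then have "card E < card S'"
      using insert by simp
    \<comment> \<open>Equation e eliminates the pivot variable \<open>s0\<close> from the others;
      \<open>y\<close> below recovers its value.\<close>
    from insert.IH[OF S(3) this, of "\<lambda>e' s. A e' s - A e' s0 * A e s / A e s0"]
    obtain x where x: "\<exists>s\<in>S'. x s \<noteq> 0"
      "\<And>e'. e' \<in> E \<Longrightarrow> (\<Sum>s\<in>S'. (A e' s - A e' s0 * A e s / A e s0) * x s) = 0"
      by blast
    define y where "y = x(s0 := - (\<Sum>s\<in>S'. A e s * x s) / A e s0)"
    have y: "(\<Sum>s\<in>S. A e' s * y s) =
        (\<Sum>s\<in>S'. A e' s * x s) - A e' s0 * (\<Sum>s\<in>S'. A e s * x s) / A e s0" for e'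
    proof -
      have "(\<Sum>s\<in>S'. A e' s * y s) = (\<Sum>s\<in>S'. A e' s * x s)"
        using S by (intro sum.cong) (auto simp: y_def)
      then show ?thesis
        using S by (simp add: y_def)
    qed
    have "(\<Sum>s\<in>S'. (A e' s - A e' s0 * A e s / A e s0) * x s) =
        (\<Sum>s\<in>S'. A e' s * x s) - A e' s0 * (\<Sum>s\<in>S'. A e s * x s) / A e s0" for e'
      by (simp add: left_diff_distrib sum_subtractf sum_distrib_left sum_divide_distrib mult.assoc)
    then have "\<forall>e'\<in>insert e E. (\<Sum>s\<in>S. A e' s * y s) = 0"
      using x(2) s0 by (auto simp: y)
    moreover have "\<exists>s\<in>S. y s \<noteq> 0"
      using x(1) S by (auto simp: y_def)
    ultimately show ?thesis by blast
  qed
qed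

text \<open>The leading monomial \<open>x\<^sup>a y\<^sup>b\<close> of \<open>g\<close> for the local degree-lexicographic order.\<close>
definition leading :: "'a::comm_ring_1 fps fps \<Rightarrow> nat \<Rightarrow> nat \<Rightarrow> bool" where
  "leading g a b \<longleftrightarrow> coeff2 g a b \<noteq> 0 \<and>
     (\<forall>i j. coeff2 g i j \<noteq> 0 \<longrightarrow> a + b < i + j \<or> a + b = i + j \<and> a \<le> i)"

lemma leading_exists:
  assumes "g \<noteq> 0"
  shows "\<exists>a b. leading g a b"
proof -
  let ?P = "\<lambda>d. \<exists>i j. coeff2 g i j \<noteq> 0 \<and> i + j = d"
  define d where "d = (LEAST d. ?P d)"
  have "\<exists>i j. coeff2 g i j \<noteq> 0"
    using assms fps2_eqI[of g 0] by auto
  then have "\<exists>d. ?P d"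
    by blast
  then have d: "?P d"
    unfolding d_def by (rule LeastI_ex[of ?P])
  let ?Q = "\<lambda>i. coeff2 g i (d - i) \<noteq> 0 \<and> i \<le> d"
  define a where "a = (LEAST i. ?Q i)"
  have "\<exists>i. ?Q i"
    using d by (metis add_diff_cancel_left' le_add1)
  then have a: "?Q a"
    unfolding a_def by (rule LeastI_ex[of ?Q])
  have "d < i + j \<or> d = i + j \<and> a \<le> i" if "coeff2 g i j \<noteq> 0" for i j
  proof -
    have "d \<le> i + j"
      unfolding d_def by (rule Least_le[of ?P]) (use that in blast)
    moreover have "a \<le> i" if "d = i + j"
      unfolding a_def by (rule Least_le[of ?Q]) (use that \<open>coeff2 g i j \<noteq> 0\<close> in auto)
    ultimately show ?thesis by linarith
  qed
  then show ?thesis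
    using a by (intro exI[of _ a] exI[of _ "d - a"]) (auto simp: leading_def)
qed

lemma leading_unique:
  assumes "leading g a b" "leading g a' b'"
  shows "a = a'" "b = b'"
proof -
  have "a + b < a' + b' \<or> a + b = a' + b' \<and> a \<le> a'" "a' + b' < a + b \<or> a' + b' = a + b \<and> a' \<le> a"
    using assms by (auto simp: leading_def)
  then show "a = a'" "b = b'" by auto
qed

text \<open>The order is total and compatible with adding exponents, so only the pair of leading
  monomials contributes at their product, and over a domain its contribution is nonzero.\<close>

lemma leading_mult:
  fixes g h :: "'a::idom fps fps"
  assumes g: "leading g a b" and h: "leading h a' b'"
  shows "leading (g * h) (a + a') (b + b')"
proof -
  have *: "a + b + (a' + b') < i + j + (i' + j') \<or>
      a + b + (a' + b') = i + j + (i' + j') \<and> a + a' \<le> i + i' \<and> (i + i' = a + a' \<longrightarrow> i = a \<and> j = b)"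
    if "coeff2 g i j * coeff2 h i' j' \<noteq> 0" for i j i' j'
  proof -
    have "a + b < i + j \<or> a + b = i + j \<and> a \<le> i" "a' + b' < i' + j' \<or> a' + b' = i' + j' \<and> a' \<le> i'"
      using g h that by (auto simp: leading_def)
    then show ?thesis by linarith
  qed
  have "coeff2 (g * h) (a + a') (b + b') =
      (\<Sum>i\<le>a+a'. \<Sum>j\<le>b+b'. if i = a then (if j = b then coeff2 g a b * coeff2 h a' b' else 0) else 0)"
    unfolding coeff2_mult
  proof (intro sum.cong refl)
    fix i j assume "i \<in> {..a+a'}" "j \<in> {..b+b'}"
    then have e: "i + (a + a' - i) = a + a'" "j + (b + b' - j) = b + b'"
      by auto
    have "i = a \<and> j = b" if "coeff2 g i j * coeff2 h (a + a' - i) (b + b' - j) \<noteq> 0"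
      using *[OF that] e by (elim disjE conjE) (linarith, blast)
    then show "coeff2 g i j * coeff2 h (a + a' - i) (b + b' - j) =
        (if i = a then (if j = b then coeff2 g a b * coeff2 h a' b' else 0) else 0)"
      by (cases "coeff2 g i j * coeff2 h (a + a' - i) (b + b' - j) = 0") auto
  qed
  also have "\<dots> = (\<Sum>i\<le>a+a'. if i = a then (\<Sum>j\<le>b+b'. if j = b then coeff2 g a b * coeff2 h a' b' else 0) else 0)"
    by (intro sum.cong) auto
  also have "\<dots> = coeff2 g a b * coeff2 h a' b'"
    by simp
  finally have "coeff2 (g * h) (a + a') (b + b') \<noteq> 0"
    using g h by (simp add: leading_def)
  moreover have "a + a' + (b + b') < p + q \<or> a + a' + (b + b') = p + q \<and> a + a' \<le> p"
    if "coeff2 (g * h) p q \<noteq> 0" for p q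
  proof -
    obtain i j where ij: "i \<le> p" "j \<le> q" "coeff2 g i j * coeff2 h (p - i) (q - j) \<noteq> 0"
      using \<open>coeff2 (g * h) p q \<noteq> 0\<close> unfolding coeff2_mult by (meson atMost_iff sum.not_neutral_contains_not_neutral)
    then show ?thesis
      using *[OF ij(3)] by linarith
  qed
  ultimately show ?thesis by (simp add: leading_def)
qed

lemma leading_cong_in_mpow:
  assumes "leading g a b" "in_mpow (g - h) n" "a + b < n"
  shows "leading h a b"
proof -
  have eq: "coeff2 h i j = coeff2 g i j" if "i + j < n" for i j
    using in_mpowD[OF assms(2) that] by simp
  have "a + b < i + j \<or> a + b = i + j \<and> a \<le> i" if "coeff2 h i j \<noteq> 0" for i j
  proof (cases "i + j < n")
    case True
    then show ?thesis
      using assms(1) that eq[OF True] by (simp add: leading_def)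
  next
    case False
    then show ?thesis
      using assms(3) by linarith
  qed
  then show ?thesis
    using assms(1) eq[OF assms(3)] by (simp add: leading_def)
qed

lemma in_mpow_leading_iff:
  assumes "leading g a b"
  shows "in_mpow g k \<longleftrightarrow> k \<le> a + b"
proof
  show "in_mpow g k \<Longrightarrow> k \<le> a + b"
    using assms by (meson in_mpowD leI leading_def)
next
  assume "k \<le> a + b"
  then show "in_mpow g k"
    using assms unfolding in_mpow_def leading_def by fastforce
qed

lemma mt_leading: "leading g a b \<Longrightarrow> mt g = a + b"
  unfolding mt_def by (rule Greatest_equality) (auto simp: in_mpow_leading_iff)

lemma coeff2_monomial_sum:
  fixes x :: "nat \<times> nat \<Rightarrow> 'a::comm_ring_1"
  assumes "finite T"
  shows "coeff2 (\<Sum>s\<in>T. mono2 (x s) (fst s) (snd s)) i j = (if (i, j) \<in> T then x (i, j) else 0)"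
proof -
  have "coeff2 (\<Sum>s\<in>T. mono2 (x s) (fst s) (snd s)) i j = (\<Sum>s\<in>T. if (i, j) = s then x (i, j) else 0)"
    unfolding coeff2_sum by (intro sum.cong) auto
  then show ?thesis
    using assms by simp
qed

section \<open>Counting monomials of bounded degree\<close>

lemma finite_degree_less: "finite {(i, j). i + j < (n::nat)}"
  by (rule finite_subset[of _ "{..<n} \<times> {..<n}"]) auto

text \<open>Dividing by x^k moves all but at most k n monomials into degree below n - k. For k =
  mt(f) this bounds the dimension of K[[x,y]]/(<f> + m^n) by k n.\<close>

lemma card_degree_less:
  assumes "k \<le> n"
  shows "card {(i, j). i + j < (n::nat)} \<le> k * n + card {(i, j). i + j < n - k}"
proof -
  have "{(i, j). i + j < n} \<subseteq> {..<k} \<times> {..<n} \<union> (\<lambda>(i, j). (i + k, j)) ` {(i, j). i + j < n - k}"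
  proof
    fix s assume "s \<in> {(i, j). i + j < n}"
    then obtain i j where s: "s = (i, j)" "i + j < n" by blast
    show "s \<in> {..<k} \<times> {..<n} \<union> (\<lambda>(i, j). (i + k, j)) ` {(i, j). i + j < n - k}"
    proof (cases "i < k")
      case False
      then have "s = (\<lambda>(i, j). (i + k, j)) (i - k, j)" "(i - k, j) \<in> {(i, j). i + j < n - k}"
        using s by auto
      then show ?thesis by blast
    qed (use s in auto)
  qed
  then have "card {(i, j). i + j < n} \<le>
      card ({..<k} \<times> {..<n} \<union> (\<lambda>(i, j). (i + k, j)) ` {(i, j). i + j < n - k})"
    by (intro card_mono) (auto intro: finite_degree_less)
  also have "\<dots> \<le> card ({..<k} \<times> {..<n}) + card ((\<lambda>(i, j). (i + k, j)) ` {(i, j). i + j < n - k})"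
    by (rule card_Un_le)
  also have "card ((\<lambda>(i, j). (i + k, j)) ` {(i, j). i + j < n - k}) \<le> card {(i, j). i + j < n - k}"
    by (intro card_image_le finite_degree_less)
  finally show ?thesis by simp
qed

section \<open>The conductor and the multiplicity\<close>

text \<open>\<open>c\<close> may be any tuple with (t^c) inside the image; this permits a second
  instance with c = 0 for smooth curves.\<close>

locale conductor_param =
  fixes r :: nat and p :: "'a::field param" and c :: "nat \<Rightarrow> nat"
  assumes J: "in_J r p"
    and lift: "\<And>u. (\<And>i. i < r \<Longrightarrow> fps_X ^ c i dvd u i) \<Longrightarrow> \<exists>g. \<forall>i<r. psi p g i = u i"
begin

lemmas psi_simps = psi_add[OF J] psi_diff[OF J] psi_mult[OF J] psi_power[OF J] psi_const[OF J]
  psi_vars[OF J] psi_zero[OF J] psi_sum[OF J]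

text \<open>The smaller of the orders of x_i(t) and y_i(t), that is, the multiplicity m_i of the
  branch.\<close>

definition branch_mult :: "nat \<Rightarrow> nat" where
  "branch_mult i = (LEAST n. fps_nth (fst (p i)) n \<noteq> 0 \<or> fps_nth (snd (p i)) n \<noteq> 0)"

text \<open>If both coordinates vanished, all images would be constant on this branch, yet the image
  contains powers of t.\<close>

lemma branch_nonzero:
  assumes i: "i < r"
  shows "\<exists>n. fps_nth (fst (p i)) n \<noteq> 0 \<or> fps_nth (snd (p i)) n \<noteq> 0"
proof (rule ccontr)
  assume "\<not> ?thesis"
  then have z: "fst (p i) = 0" "snd (p i) = 0"
    by (auto simp: fps_eq_iff)
  \<comment> \<open>The positive exponent c_j + 1 forces the constant term of g to vanish.\<close>
  obtain g where g: "\<And>j. j < r \<Longrightarrow> psi p g j = fps_X ^ Suc (c j)"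
    using lift[of "\<lambda>j. fps_X ^ Suc (c j)"] by auto
  have "coeff2 g 0 0 = 0"
    using psi_nth_0[OF J i, of g] g[OF i] by simp
  then have "fps_X ^ (Suc 0 * Suc (Suc (c i))) dvd psi p g i"
    using z by (intro psi_order) (auto simp: in_mpow_1)
  then have "fps_nth (psi p g i) (Suc (c i)) = 0"
    by (simp add: fps_X_power_dvd_iff del: power_Suc)
  then show False
    using g[OF i] by (simp del: power_Suc add: fps_X_power_nth)
qed

lemma branch_mult_dvd:
  assumes "i < r"
  shows "fps_X ^ branch_mult i dvd fst (p i)" "fps_X ^ branch_mult i dvd snd (p i)"
  unfolding fps_X_power_dvd_iff branch_mult_def by (auto dest: not_less_Least)

text \<open>The coordinate attaining the minimal order is t^(m_i) times a unit.\<close>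

lemma dvd_branch_mult:
  assumes "i < r"
  shows "fst (p i) dvd fps_X ^ branch_mult i \<or> snd (p i) dvd fps_X ^ branch_mult i"
proof -
  have *: "u dvd fps_X ^ n" if "fps_nth u n \<noteq> 0" for u :: "'a fps" and n
    using that subdegree_leI[OF that] by (subst fps_dvd_iff) auto
  show ?thesis
    using * LeastI_ex[OF branch_nonzero[OF assms]] unfolding branch_mult_def by blast
qed

lemma branch_mult_pos:
  assumes "i < r"
  shows "0 < branch_mult i"
proof (rule ccontr)
  assume "\<not> ?thesis"
  then show False
    using LeastI_ex[OF branch_nonzero[OF assms]] J assms by (auto simp: branch_mult_def in_J_def)
qed

lemma psi_order_branch:
  "in_mpow g n \<Longrightarrow> i < r \<Longrightarrow> fps_X ^ (n * branch_mult i) dvd psi p g i"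
  by (intro psi_order branch_mult_dvd)

text \<open>The preimage of (t^c) in K[[x,y]]; it contains the kernel.\<close>

definition cond_ideal :: "'a fps fps set" where
  "cond_ideal = {g. \<forall>i<r. fps_X ^ c i dvd psi p g i}"

lemma cond_ideal_diff: "g \<in> cond_ideal \<Longrightarrow> h \<in> cond_ideal \<Longrightarrow> g - h \<in> cond_ideal"
  by (auto simp: cond_ideal_def psi_simps)

lemma cond_ideal_mult: "g \<in> cond_ideal \<Longrightarrow> h * g \<in> cond_ideal"
  by (auto simp: cond_ideal_def psi_simps)

text \<open>On each branch x or y generates (t^(m_i)), so its n-th power divides u and the other
  n-th power gets coefficient 0. The coefficients, chosen branch by branch in (t^c), lift
  simultaneously.\<close>

lemma lift_power:
  assumes u: "\<And>i. i < r \<Longrightarrow> fps_X ^ (n * branch_mult i + c i) dvd u i"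
  shows "\<exists>g\<in>cond_ideal. \<exists>h\<in>cond_ideal. \<forall>i<r. psi p (fps_const fps_X ^ n * g + fps_X ^ n * h) i = u i"
proof -
  have "\<exists>v w. fps_X ^ c i dvd v \<and> fps_X ^ c i dvd w \<and> u i = fst (p i) ^ n * v + snd (p i) ^ n * w"
    if i: "i < r" for i
  proof -
    obtain e where e: "u i = (fps_X ^ branch_mult i) ^ n * (fps_X ^ c i * e)"
      using u[OF i] by (auto elim!: dvdE simp: power_add power_mult mult.assoc mult.commute[of n])
    have "fst (p i) ^ n dvd (fps_X ^ branch_mult i) ^ n \<or> snd (p i) ^ n dvd (fps_X ^ branch_mult i) ^ n"
      using dvd_branch_mult[OF i] by (auto intro: dvd_power_same)
    then show ?thesis
    proof
      assume "fst (p i) ^ n dvd (fps_X ^ branch_mult i) ^ n"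
      then obtain z where "(fps_X ^ branch_mult i) ^ n = fst (p i) ^ n * z" ..
      with e show ?thesis
        by (intro exI[of _ "fps_X ^ c i * (z * e)"] exI[of _ 0]) (simp add: ac_simps)
    next
      assume "snd (p i) ^ n dvd (fps_X ^ branch_mult i) ^ n"
      then obtain z where "(fps_X ^ branch_mult i) ^ n = snd (p i) ^ n * z" ..
      with e show ?thesis
        by (intro exI[of _ "fps_X ^ c i * (z * e)"] exI[of _ 0]) (simp add: ac_simps)
    qed
  qed
  then obtain v w where vw: "\<And>i. i < r \<Longrightarrow> fps_X ^ c i dvd v i" "\<And>i. i < r \<Longrightarrow> fps_X ^ c i dvd w i"
    "\<And>i. i < r \<Longrightarrow> u i = fst (p i) ^ n * v i + snd (p i) ^ n * w i"
    by metis
  obtain g h where gh: "\<And>i. i < r \<Longrightarrow> psi p g i = v i" "\<And>i. i < r \<Longrightarrow> psi p h i = w i"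
    using lift[of v] lift[of w] vw by metis
  show ?thesis
    by (rule bexI[of _ g], rule bexI[of _ h])
      (use vw gh in \<open>auto simp: psi_simps cond_ideal_def simp del: fps_const_power\<close>)
qed

lemma lift_monomials:
  obtains G where
    "\<And>i j k. c i \<le> j \<Longrightarrow> k < r \<Longrightarrow> psi p (G (i, j)) k = (if k = i then fps_X ^ j else 0)"
proof -
  have "\<exists>g. c i \<le> j \<longrightarrow> (\<forall>k<r. psi p g k = (if k = i then fps_X ^ j else 0))" for i j
  proof (cases "c i \<le> j")
    case True
    then show ?thesis
      using lift[of "\<lambda>k. if k = i then fps_X ^ j else 0"] by (auto simp: le_imp_power_dvd)
  qed auto
  then have "\<exists>G. \<forall>i j. c i \<le> j \<longrightarrow> (\<forall>k<r. psi p (G i j) k = (if k = i then fps_X ^ j else 0))"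
    by metis
  then obtain G where G: "\<And>i j k. c i \<le> j \<Longrightarrow> k < r \<Longrightarrow> psi p (G i j) k = (if k = i then fps_X ^ j else 0)"
    by blast
  show ?thesis
    by (rule that[of "\<lambda>(i, j). G i j"]) (simp add: G)
qed

text \<open>This is the linear independence of the lifted monomials, with the scalars read off
  explicitly.\<close>

lemma psi_combination_nth:
  assumes G: "\<And>i j k. c i \<le> j \<Longrightarrow> k < r \<Longrightarrow> psi p (G (i, j)) k = (if k = i then fps_X ^ j else 0)"
    and S: "finite S" "S \<subseteq> {(i, j). i < r \<and> c i \<le> j}" and ij: "(i, j) \<in> S"
  shows "fps_nth (psi p (\<Sum>s\<in>S. fps_const (fps_const (x s)) * G s) i) j = x (i, j)"
proof -
  have i: "i < r" using S ij by auto
  have "fps_nth (psi p (\<Sum>s\<in>S. fps_const (fps_const (x s)) * G s) i) j =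
      (\<Sum>s\<in>S. fps_nth (psi p (fps_const (fps_const (x s)) * G s) i) j)"
    using i by (simp add: psi_sum[OF J] fps_sum_nth)
  also have "\<dots> = (\<Sum>s\<in>S. if (i, j) = s then x (i, j) else 0)"
  proof (intro sum.cong refl)
    fix s assume s: "s \<in> S"
    obtain k l where kl: "s = (k, l)" by (cases s)
    with s S have "c k \<le> l" by auto
    then show "fps_nth (psi p (fps_const (fps_const (x s)) * G s) i) j = (if (i, j) = s then x (i, j) else 0)"
      using i by (auto simp: kl psi_mult[OF J] psi_const[OF J] G fps_X_power_nth)
  qed
  also have "\<dots> = x (i, j)"
    using S ij by simp
  finally show ?thesis .
qed

text \<open>A Nakayama count: (t^c)/(t^(c+m)) has dimension the sum of the m_i, whereas an element
  of order at most one would leave the ideal with two generators.\<close>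

lemma cond_ideal_order_ge_2:
  assumes m: "2 < (\<Sum>i<r. branch_mult i)" and a: "a \<in> cond_ideal"
  shows "in_mpow a 2"
proof (rule ccontr)
  assume "\<not> in_mpow a 2"
  then obtain b where b: "b \<in> cond_ideal" "\<And>g. g \<in> cond_ideal \<Longrightarrow> \<exists>u v. g = u * a + v * b"
    using ideal_order_one_two_generators[OF cond_ideal_diff cond_ideal_mult a] by blast
  obtain G where G: "\<And>i j k. c i \<le> j \<Longrightarrow> k < r \<Longrightarrow> psi p (G (i, j)) k = (if k = i then fps_X ^ j else 0)"
    using lift_monomials by blast
  \<comment> \<open>These t^j form a basis of (t^c)/(t^(c+m)).\<close>
  define S where "S = Sigma {..<r} (\<lambda>i. {c i..<c i + branch_mult i})"
  have S: "finite S" "S \<subseteq> {(i, j). i < r \<and> c i \<le> j}" and cS: "card S = (\<Sum>i<r. branch_mult i)"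
    by (auto simp: S_def)
  have "G s \<in> cond_ideal" if "s \<in> S" for s
    using that S by (cases s) (auto simp: cond_ideal_def G le_imp_power_dvd)
  then have "\<forall>s\<in>S. \<exists>u v. G s = u * a + v * b"
    using b by blast
  then obtain U V where UV: "\<And>s. s \<in> S \<Longrightarrow> G s = U s * a + V s * b"
    by metis
  \<comment> \<open>Two equations, indexed by \<open>bool\<close>: the coefficients at a and at b of
    the combined lifts lose their constant terms.\<close>
  obtain x where x: "\<exists>s\<in>S. x s \<noteq> 0"
    "\<And>e. e \<in> UNIV \<Longrightarrow> (\<Sum>s\<in>S. (if e then coeff2 (U s) 0 0 else coeff2 (V s) 0 0) * x s) = 0"
    using homogeneous_system_nontrivial_solution[of "UNIV :: bool set" S
        "\<lambda>e s. if e then coeff2 (U s) 0 0 else coeff2 (V s) 0 0"] S m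
    by (auto simp: cS)
  define u where "u = (\<Sum>s\<in>S. fps_const (fps_const (x s)) * U s)"
  define v where "v = (\<Sum>s\<in>S. fps_const (fps_const (x s)) * V s)"
  define g where "g = (\<Sum>s\<in>S. fps_const (fps_const (x s)) * G s)"
  have "g = u * a + v * b"
    unfolding g_def u_def v_def sum_distrib_right sum.distrib[symmetric]
    by (intro sum.cong refl) (simp add: UV algebra_simps)
  \<comment> \<open>Now u, v lie in m, so the combination falls into (t^(c+m)), beyond every t^j
    from \<open>S\<close>.\<close>
  moreover have "in_mpow u 1" "in_mpow v 1"
    using x(2)[of True] x(2)[of False] by (auto simp: in_mpow_1 u_def v_def mult.commute[of _ "x _"])
  then have "fps_X ^ (1 * branch_mult i) dvd psi p u i" "fps_X ^ (1 * branch_mult i) dvd psi p v i" if "i < r" for i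
    using psi_order_branch that by blast+
  ultimately have g: "fps_X ^ (c i + branch_mult i) dvd psi p g i" if "i < r" for i
    using that a b(1)
    by (auto simp: psi_simps power_add cond_ideal_def mult.commute intro!: dvd_add mult_dvd_mono)
  obtain i j where ij: "(i, j) \<in> S" "x (i, j) \<noteq> 0"
    using x(1) by auto
  then have "fps_nth (psi p g i) j = 0"
    using g[of i] by (auto simp: S_def fps_X_power_dvd_iff)
  then show False
    using psi_combination_nth[OF G S ij(1), of x] ij(2) by (simp add: g_def)
qed

text \<open>In \<open>K[[x,y]]/(\<langle>f\<rangle> + \<mm>\<^sup>n)\<close> at most \<open>n mt(f)\<close> elements are independent, whereas the lifts of the
  \<open>n m\<^sub>i - c\<^sub>i\<close> powers \<open>t\<^sup>j\<close> with \<open>c\<^sub>i \<le> j < n m\<^sub>i\<close> on the branches are independent there.\<close>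
lemma sum_branch_mult_le_order:
  assumes f: "leading f a b" and ker: "\<And>g i. f dvd g \<Longrightarrow> i < r \<Longrightarrow> psi p g i = 0"
  shows "(\<Sum>i<r. branch_mult i) \<le> a + b"
proof (rule ccontr)
  define m where "m = a + b"
  \<comment> \<open>n >= m is required by the monomial count, and n above the sum of the c_i makes
    the comparison strict.\<close>
  define n where "n = Suc (m + (\<Sum>i<r. c i))"
  assume "\<not> ?thesis"
  then have m: "Suc m \<le> (\<Sum>i<r. branch_mult i)"
    by (simp add: m_def)
  obtain G where G: "\<And>i j k. c i \<le> j \<Longrightarrow> k < r \<Longrightarrow> psi p (G (i, j)) k = (if k = i then fps_X ^ j else 0)"
    using lift_monomials by blast
  define S where "S = Sigma {..<r} (\<lambda>i. {c i..<n * branch_mult i})"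
  define T where "T = {(i, j). i + j < n - m}"
  have S: "finite S" "S \<subseteq> {(i, j). i < r \<and> c i \<le> j}" and T: "finite T"
    by (auto simp: S_def T_def finite_degree_less)
  have "n * Suc m \<le> n * (\<Sum>i<r. branch_mult i)"
    using m by (rule mult_le_mono2)
  also have "\<dots> = (\<Sum>i<r. n * branch_mult i)"
    by (rule sum_distrib_left)
  also have "\<dots> \<le> (\<Sum>i<r. (n * branch_mult i - c i) + c i)"
    by (intro sum_mono) auto
  also have "\<dots> = card S + (\<Sum>i<r. c i)"
    by (simp add: S_def sum.distrib)
  finally have "m * n < card S"
    by (simp add: n_def algebra_simps)
  then have "card {(i, j). i + j < n} < card (S <+> T)"
    using card_degree_less[of m n] S T by (simp add: card_Plus T_def n_def)
  \<comment> \<open>The unknowns are the coefficients of the lifts (\<open>Inl\<close>) and of a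
    multiplier h of f (\<open>Inr\<close>); the equations put g + h f into m^n.\<close>
  then obtain x where x: "\<exists>s\<in>S <+> T. x s \<noteq> 0" "\<And>e. e \<in> {(i, j). i + j < n} \<Longrightarrow>
      (\<Sum>s\<in>S <+> T. (case s of Inl s \<Rightarrow> coeff2 (G s) (fst e) (snd e)
         | Inr (i, j) \<Rightarrow> coeff2 (mono2 1 i j * f) (fst e) (snd e)) * x s) = 0"
    using homogeneous_system_nontrivial_solution[OF finite_degree_less[of n] finite_Plus[OF S(1) T],
        of "\<lambda>e s. case s of Inl s \<Rightarrow> coeff2 (G s) (fst e) (snd e)
         | Inr (i, j) \<Rightarrow> coeff2 (mono2 1 i j * f) (fst e) (snd e)"] by blast
  define g where "g = (\<Sum>s\<in>S. fps_const (fps_const (x (Inl s))) * G s)"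
  define h where "h = (\<Sum>s\<in>T. mono2 (x (Inr s)) (fst s) (snd s))"
  have hf: "h * f = (\<Sum>s\<in>T. fps_const (fps_const (x (Inr s))) * (mono2 1 (fst s) (snd s) * f))"
    unfolding h_def sum_distrib_right by (intro sum.cong refl) (simp add: mono2_def mult.assoc)
  have gh: "in_mpow (g + h * f) n"
    unfolding in_mpow_def
  proof (intro allI impI)
    fix i j assume "i + j < n"
    with x(2)[of "(i, j)"] show "coeff2 (g + h * f) i j = 0"
      by (simp add: sum.Plus S T g_def hf case_prod_beta mult.commute[of _ "x _"])
  qed
  \<comment> \<open>Since f vanishes on the branches, g alone has order at least n m_i there, beyond
    all exponents in \<open>S\<close>.\<close>
  have x0: "x (Inl s) = 0" if "s \<in> S" for s
  proof -
    obtain i j where s: "s = (i, j)" by (cases s)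
    then have i: "i < r" "j < n * branch_mult i"
      using that by (auto simp: S_def)
    have "psi p (g + h * f) i = psi p g i"
      using ker[of "h * f" i] i by (simp add: psi_add[OF J])
    then have "fps_X ^ (n * branch_mult i) dvd psi p g i"
      using psi_order_branch[OF gh] i by fastforce
    then have "fps_nth (psi p g i) j = 0"
      using i by (auto simp: fps_X_power_dvd_iff)
    then show ?thesis
      using psi_combination_nth[OF G S, of i j "\<lambda>s. x (Inl s)"] that by (simp add: s g_def)
  qed
  then have "g = 0"
    by (simp add: g_def)
  \<comment> \<open>It remains that h f lies in m^n with h nonzero of order below n - m, against
    additivity of leading degrees.\<close>
  obtain s where s: "s \<in> T" "x (Inr s) \<noteq> 0"
    using x(1) x0 by auto
  then have hs: "coeff2 h (fst s) (snd s) \<noteq> 0"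
    using T by (simp add: h_def coeff2_monomial_sum del: coeff2_sum)
  then have "h \<noteq> 0" by auto
  then obtain a' b' where h: "leading h a' b'"
    using leading_exists by blast
  have "a' + b' \<le> fst s + snd s"
    using h hs unfolding leading_def by (metis less_imp_le_nat order_refl)
  then have "a' + b' < n - m"
    using s by (auto simp: T_def)
  moreover have "leading (h * f) (a' + a) (b' + b)"
    by (rule leading_mult[OF h f])
  then have "n \<le> (a' + a) + (b' + b)"
    using gh \<open>g = 0\<close> by (simp add: in_mpow_leading_iff)
  ultimately show False
    by (auto simp: m_def)
qed

text \<open>The monomials of degree below \<open>n\<close> outside the ideal of the leading monomial of \<open>f\<close> stay
  independent modulo \<open>\<langle>f\<rangle> + \<mm>\<^sup>n\<close>, hence modulo \<open>\<mm>\<^sup>n C = (t^(n m\<^sub>i + c\<^sub>i))\<close>.\<close>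
lemma order_le_sum_branch_mult:
  assumes f: "leading f a b" and ker: "\<And>g. (\<And>i. i < r \<Longrightarrow> psi p g i = 0) \<Longrightarrow> f dvd g"
  shows "a + b \<le> (\<Sum>i<r. branch_mult i)"
proof (rule ccontr)
  define m where "m = a + b"
  \<comment> \<open>\<open>card S - card E\<close> will be at least n - m^2 minus the sum of the
    c_i, which this choice makes 1.\<close>
  define n where "n = Suc (m * m + (\<Sum>i<r. c i))"
  assume "\<not> ?thesis"
  then have m: "Suc (\<Sum>i<r. branch_mult i) \<le> m"
    by (simp add: m_def)
  \<comment> \<open>\<open>S1\<close> and \<open>S2\<close> are disjoint strips of monomials not
    divisible by x^a y^b, m (n - m) in number.\<close>
  define S1 where "S1 = (\<lambda>(i, k). (i, b + k)) ` ({..<a} \<times> {..<n - m})"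
  define S2 where "S2 = (\<lambda>(k, j). (k, j)) ` ({..<n - m} \<times> {..<b})"
  define S where "S = S1 \<union> S2"
  have S: "finite S"
    by (simp add: S_def S1_def S2_def)
  have S_cases: "i + j < n \<and> (i < a \<or> j < b)" if "(i, j) \<in> S" for i j
    using that by (auto simp: S_def S1_def S2_def m_def)
  have "card S = card S1 + card S2"
    unfolding S_def by (intro card_Un_disjoint) (auto simp: S1_def S2_def)
  also have "card S1 = a * (n - m)"
    unfolding S1_def by (subst card_image) (auto simp: inj_on_def)
  also have "card S2 = (n - m) * b"
    unfolding S2_def by (subst card_image) (auto simp: inj_on_def)
  finally have cS: "card S = m * (n - m)"
    unfolding m_def by (simp only: add_mult_distrib mult.commute)
  define E where "E = Sigma {..<r} (\<lambda>i. {..<n * branch_mult i + c i})"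
  have E: "finite E" and cE: "card E = n * (\<Sum>i<r. branch_mult i) + (\<Sum>i<r. c i)"
    by (simp_all add: E_def sum.distrib sum_distrib_left)
  have "card E + n = n * Suc (\<Sum>i<r. branch_mult i) + (\<Sum>i<r. c i)"
    by (simp add: cE)
  also have "\<dots> \<le> n * m + (\<Sum>i<r. c i)"
    using mult_le_mono2[OF m, of n] by simp
  also have "m \<le> n"
    by (simp add: n_def le_square le_SucI trans_le_add1)
  then have "n * m = m * (n - m) + m * m"
    by (metis add_mult_distrib2 le_add_diff_inverse2 mult.commute)
  also have "m * (n - m) + m * m + (\<Sum>i<r. c i) < card S + n"
    by (simp add: cS n_def)
  finally have "card E < card S"
    by simp
  then obtain x where x: "\<exists>s\<in>S. x s \<noteq> 0"
    "\<And>e. e \<in> E \<Longrightarrow> (\<Sum>s\<in>S. fps_nth (psi p (mono2 1 (fst s) (snd s)) (fst e)) (snd e) * x s) = 0"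
    using homogeneous_system_nontrivial_solution[OF E S,
        of "\<lambda>e s. fps_nth (psi p (mono2 1 (fst s) (snd s)) (fst e)) (snd e)"] by blast
  define g where "g = (\<Sum>s\<in>S. mono2 (x s) (fst s) (snd s))"
  have g: "fps_X ^ (n * branch_mult i + c i) dvd psi p g i" if i: "i < r" for i
    unfolding fps_X_power_dvd_iff
  proof (intro allI impI)
    fix k assume k: "k < n * branch_mult i + c i"
    have "fps_nth (psi p g i) k = (\<Sum>s\<in>S. fps_nth (psi p (mono2 (x s) (fst s) (snd s)) i) k)"
      using i by (simp add: g_def psi_sum[OF J] fps_sum_nth)
    also have "\<dots> = (\<Sum>s\<in>S. fps_nth (psi p (mono2 1 (fst s) (snd s)) i) k * x s)"
    proof (intro sum.cong refl)
      fix s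
      have "mono2 (x s) (fst s) (snd s) = fps_const (fps_const (x s)) * mono2 1 (fst s) (snd s)"
        by (simp add: mono2_def)
      then show "fps_nth (psi p (mono2 (x s) (fst s) (snd s)) i) k =
          fps_nth (psi p (mono2 1 (fst s) (snd s)) i) k * x s"
        using i by (simp add: psi_mult[OF J] psi_const[OF J])
    qed
    also have "\<dots> = 0"
      using x(2)[of "(i, k)"] i k by (simp add: E_def)
    finally show "fps_nth (psi p g i) k = 0" .
  qed
  \<comment> \<open>The image of g has a second preimage in m^n. The difference is a multiple of f
    but keeps the leading monomial of g, which x^a y^b does not divide.\<close>
  obtain g1 g2 where g12: "\<And>i. i < r \<Longrightarrow> psi p (fps_const fps_X ^ n * g1 + fps_X ^ n * g2) i = psi p g i"
    using lift_power[of n "psi p g"] g by blast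
  define g' where "g' = fps_const fps_X ^ n * g1 + fps_X ^ n * g2"
  have g': "in_mpow g' n"
    unfolding g'_def using in_mpow_power[OF in_mpow_vars(1), of n] in_mpow_power[OF in_mpow_vars(2), of n]
    by (intro in_mpow_add mult_in_mpow) simp_all
  have "f dvd g - g'"
    by (rule ker) (simp add: psi_diff[OF J] g12 g'_def del: fps_const_power)
  then obtain h where h: "g - g' = f * h" ..
  obtain s where s: "s \<in> S" "x s \<noteq> 0"
    using x(1) by auto
  have gc: "coeff2 g i j = (if (i, j) \<in> S then x (i, j) else 0)" for i j
    unfolding g_def by (rule coeff2_monomial_sum[OF S])
  then have "g \<noteq> 0"
    using s by (metis coeff2_simps(4) prod.collapse)
  then obtain a1 b1 where lg: "leading g a1 b1"
    using leading_exists by blast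
  then have "(a1, b1) \<in> S"
    using gc[of a1 b1] by (auto simp: leading_def split: if_splits)
  from S_cases[OF this] have a1: "a1 + b1 < n" "a1 < a \<or> b1 < b"
    by auto
  have lfh: "leading (f * h) a1 b1"
    by (rule leading_cong_in_mpow[OF lg _ a1(1)]) (simp add: h[symmetric] g')
  then have "h \<noteq> 0"
    by (auto simp: leading_def)
  then obtain a2 b2 where "leading h a2 b2"
    using leading_exists by blast
  from leading_unique[OF lfh leading_mult[OF f this]] show False
    using a1(2) by auto
qed

section \<open>Determinacy bounds from conductor and multiplicity\<close>

lemma param_determined_if_cond_le:
  assumes m: "2 < (\<Sum>i<r. branch_mult i)" and k: "\<And>i. i < r \<Longrightarrow> c i \<le> Suc (k i)"
  shows "param_determined r k p"
proof (rule param_determined_if_msquare[OF J])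
  fix u :: "nat \<Rightarrow> 'a fps" assume "\<And>i. i < r \<Longrightarrow> fps_X ^ Suc (k i) dvd u i"
  then have u: "fps_X ^ c i dvd u i" if "i < r" for i
    using that k by (meson dvd_trans le_imp_power_dvd)
  then obtain a where a: "\<And>i. i < r \<Longrightarrow> psi p a i = u i"
    using lift[of u] by blast
  with u have "in_mpow a 2"
    by (intro cond_ideal_order_ge_2 m) (simp add: cond_ideal_def)
  with a show "\<exists>a. in_mpow a 2 \<and> (\<forall>i<r. psi p a i = u i)" by blast
qed

text \<open>A unit in this ideal forces c = 0, so the image is everything. Being local, it admits no
  idempotent separating two branches; containing t, it needs a coordinate of order one.\<close>

lemma cond_ideal_unit:
  assumes g: "g \<in> cond_ideal" "coeff2 g 0 0 \<noteq> 0"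
  shows "r \<le> 1" and "\<And>i. i < r \<Longrightarrow> c i = 0" and "\<And>i. i < r \<Longrightarrow> branch_mult i = 1"
proof -
  show c: "c i = 0" if "i < r" for i
  proof (rule ccontr)
    assume "c i \<noteq> 0"
    then have "fps_nth (psi p g i) 0 = 0"
      using g(1) that by (simp add: cond_ideal_def fps_X_power_dvd_iff)
    then show False
      using psi_nth_0[OF J that, of g] g(2) by simp
  qed
  show "r \<le> 1"
  proof (rule ccontr)
    assume "\<not> r \<le> 1"
    then have r: "0 < r" "1 < r" by auto
    obtain h where "\<And>i. i < r \<Longrightarrow> psi p h i = (if i = 0 then 1 else 0)"
      using lift[of "\<lambda>i. if i = 0 then 1 else 0"] c by auto
    with psi_nth_0[OF J r(1), of h] psi_nth_0[OF J r(2), of h] r show False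
      by simp
  qed
  show "branch_mult i = 1" if "i < r" for i
  proof -
    obtain h where h: "\<And>i. i < r \<Longrightarrow> psi p h i = fps_X"
      using lift[of "\<lambda>i. fps_X"] c by auto
    then have "in_mpow h 1"
      using psi_nth_0[OF J that, of h] that by (simp add: in_mpow_1)
    from psi_order_branch[OF this that] have "\<not> 1 < branch_mult i"
      using h[OF that] by (auto simp: fps_X_power_dvd_iff)
    then show ?thesis
      using branch_mult_pos[OF that] by simp
  qed
qed

text \<open>If \<open>cond_ideal\<close> lies in m, then (t^(c+m)) lifts to m^2 through x and y.
  Otherwise r <= 1, c = 0 and m = 1, and \<open>k1\<close> makes u of order at least 2 = 2 m + c, so
  that it lifts through x^2 and y^2.\<close>

lemma param_determined_if_cond_plus_mult_le:
  assumes k: "\<And>i. i < r \<Longrightarrow> branch_mult i + c i \<le> Suc (k i)"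
    and k1: "\<And>i. i < r \<Longrightarrow> r \<le> 1 \<Longrightarrow> 1 \<le> k i"
  shows "param_determined r k p"
proof (rule param_determined_if_msquare[OF J])
  fix u :: "nat \<Rightarrow> 'a fps" assume u: "\<And>i. i < r \<Longrightarrow> fps_X ^ Suc (k i) dvd u i"
  show "\<exists>a. in_mpow a 2 \<and> (\<forall>i<r. psi p a i = u i)"
  proof (cases "\<forall>g\<in>cond_ideal. in_mpow g 1")
    case True
    have "fps_X ^ (1 * branch_mult i + c i) dvd u i" if "i < r" for i
      using k u that by (metis dvd_trans le_imp_power_dvd nat_mult_1)
    then obtain g h where gh: "g \<in> cond_ideal" "h \<in> cond_ideal"
      "\<forall>i<r. psi p (fps_const fps_X ^ 1 * g + fps_X ^ 1 * h) i = u i"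
      using lift_power[of 1 u] by blast
    have "in_mpow (fps_const fps_X * g + fps_X * h) (Suc 0 + 1)"
      using True gh by (intro in_mpow_add in_mpow_mult in_mpow_vars) auto
    with gh(3) show ?thesis
      by (intro exI[of _ "fps_const fps_X * g + fps_X * h"]) (simp add: numeral_2_eq_2)
  next
    case False
    then obtain g where g: "g \<in> cond_ideal" "coeff2 g 0 0 \<noteq> 0"
      by (auto simp: in_mpow_1)
    have "fps_X ^ (2 * branch_mult i + c i) dvd u i" if i: "i < r" for i
    proof -
      have "2 * branch_mult i + c i \<le> Suc (k i)"
        using cond_ideal_unit[OF g] i k1[OF i] by simp
      then show ?thesis
        using u[OF i] by (meson dvd_trans le_imp_power_dvd)
    qed
    then obtain g h where gh: "\<forall>i<r. psi p (fps_const fps_X ^ 2 * g + fps_X ^ 2 * h) i = u i"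
      using lift_power[of 2 u] by blast
    have "in_mpow (fps_const fps_X ^ 2 * g + fps_X ^ 2 * h :: 'a fps fps) 2"
      using in_mpow_power[OF in_mpow_vars(1), of 2] in_mpow_power[OF in_mpow_vars(2), of 2]
      by (intro in_mpow_add mult_in_mpow) simp_all
    with gh show ?thesis by blast
  qed
qed

text \<open>One coordinate is a uniformizer of the single branch; subtracting scalar multiples of
  its powers raises the order until \<open>lift\<close> applies.\<close>

lemma lift_if_smooth:
  assumes "(\<Sum>i<r. branch_mult i) \<le> 1"
  shows "\<exists>g. \<forall>i<r. psi p g i = u i"
proof (cases "r = 0")
  case False
  have "(\<Sum>i<r. 1) \<le> (\<Sum>i<r. branch_mult i)"
    using branch_mult_pos by (intro sum_mono) (simp add: Suc_le_eq)
  with False assms have r: "r = 1"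
    by simp
  with assms branch_mult_pos[of 0] have m: "branch_mult 0 = 1"
    by simp
  have "\<exists>b. psi p b 0 dvd fps_X \<and> fps_X dvd psi p b 0"
  proof -
    have "fps_X dvd fst (p 0)" "fps_X dvd snd (p 0)" "fst (p 0) dvd fps_X \<or> snd (p 0) dvd fps_X"
      using dvd_branch_mult[of 0] branch_mult_dvd[of 0] r m by simp_all
    moreover have "psi p (fps_const fps_X) 0 = fst (p 0)" "psi p fps_X 0 = snd (p 0)"
      using psi_vars[OF J, of 0] r by simp_all
    ultimately show ?thesis by metis
  qed
  then obtain b where b: "psi p b 0 dvd fps_X" "fps_X dvd psi p b 0" by blast
  \<comment> \<open>Each step lowers by one the order known to suffice, from c down to 0.\<close>
  have down: "\<forall>u. fps_X ^ (c 0 - n) dvd u \<longrightarrow> (\<exists>g. psi p g 0 = u)" for n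
  proof (induction n)
    case 0
    show ?case
    proof (intro allI impI)
      fix u :: "'a fps" assume "fps_X ^ (c 0 - 0) dvd u"
      then show "\<exists>g. psi p g 0 = u"
        using lift[of "\<lambda>_. u"] r by auto
    qed
  next
    case (Suc n)
    define l where "l = c 0 - Suc n"
    show ?case
    proof (cases "c 0 - n = 0")
      case True
      then show ?thesis using Suc by simp
    next
      case False
      then have n: "c 0 - n = Suc l" by (simp add: l_def)
      show ?thesis
      proof (intro allI impI)
        fix u :: "'a fps" assume "fps_X ^ (c 0 - Suc n) dvd u"
        then obtain w where w: "u = fps_X ^ l * w"
          by (auto simp: l_def)
        have "psi p b 0 ^ l dvd fps_X ^ l"
          using b(1) by (rule dvd_power_same)
        then obtain z where z: "fps_X ^ l = psi p b 0 ^ l * z" ..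
        \<comment> \<open>This scalar cancels the term of order l, because u is the l-th power of
          the uniformizer times z w.\<close>
        let ?k = "fps_nth (z * w) 0"
        have "u - psi p b 0 ^ l * fps_const ?k = psi p b 0 ^ l * (z * w - fps_const ?k)"
          by (simp add: w z algebra_simps)
        moreover have "fps_X ^ l dvd psi p b 0 ^ l"
          using b(2) by (rule dvd_power_same)
        moreover have "fps_X ^ 1 dvd z * w - fps_const ?k"
          by (simp only: fps_X_power_dvd_iff) simp
        ultimately have "fps_X ^ (l + 1) dvd u - psi p b 0 ^ l * fps_const ?k"
          by (simp only: power_add mult_dvd_mono)
        then obtain g where g: "psi p g 0 = u - psi p b 0 ^ l * fps_const ?k"
          using Suc n by auto
        show "\<exists>g. psi p g 0 = u"
          using r by (intro exI[of _ "g + b ^ l * fps_const (fps_const ?k)"]) (simp add: psi_simps g)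
      qed
    qed
  qed
  show ?thesis
    using down[of "c 0"] r by simp
qed auto

end

theorem theorem2p1:
  fixes f :: "'k::alg_closed_field fps fps" and r :: nat
    and p :: "'k param" and c :: "nat \<Rightarrow> nat"
  assumes "in_mpow f 1"
    and "squarefree f"
    and "num_branches f r"
    and "is_parametrization f r p"
    and "conductor r p c"
  shows "(mt f = 1 \<longrightarrow> param_determined r (\<lambda>i. 1) p)
       \<and> (mt f = 2 \<and> r = 1 \<longrightarrow> param_determined r (\<lambda>i. c i + 1) p)
       \<and> (mt f = 2 \<and> r = 2 \<longrightarrow> param_determined r c p)
       \<and> (mt f > 2 \<longrightarrow> param_determined r (\<lambda>i. c i - 1) p)
       \<and> param_determined r (\<lambda>i. c i + 1) p"
proof -
  have J: "in_J r p" and ker: "\<And>g. (\<forall>i<r. psi p g i = 0) \<longleftrightarrow> f dvd g"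
    using assms(4) by (auto simp: is_parametrization_def)
  interpret conductor_param r p c
  proof
    fix u :: "nat \<Rightarrow> 'k fps" assume "\<And>i. i < r \<Longrightarrow> fps_X ^ c i dvd u i"
    then have "in_image r p u"
      using assms(5) unfolding conductor_def fps_X_power_dvd_iff by blast
    then show "\<exists>g. \<forall>i<r. psi p g i = u i"
      by (auto simp: in_image_def)
  qed (rule J)
  have "f \<noteq> 0"
    using assms(2) by auto
  then obtain a b where f: "leading f a b"
    using leading_exists by blast
  have mt: "mt f = (\<Sum>i<r. branch_mult i)"
    using mt_leading[OF f] sum_branch_mult_le_order[OF f] order_le_sum_branch_mult[OF f] ker
    by (metis le_antisym)
  have branch_le: "branch_mult i \<le> mt f" if "i < r" for i
    unfolding mt using that by (intro member_le_sum) auto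
  \<comment> \<open>The form c <= k + 1 serves both k = c - 1, even when c_i = 0, and k = c +
    1.\<close>
  have high: "param_determined r k p" if "mt f > 2" "\<And>i. i < r \<Longrightarrow> c i \<le> Suc (k i)" for k
    using that by (intro param_determined_if_cond_le) (simp_all add: mt)
  \<comment> \<open>Here every m_i is at most 2, hence c + m <= (c + 1) + 1.\<close>
  have low: "param_determined r (\<lambda>i. c i + 1) p" if "mt f \<le> 2"
    using that branch_le by (intro param_determined_if_cond_plus_mult_le) (fastforce, simp)
  have smooth: "param_determined r (\<lambda>i. 1) p" if "mt f = 1"
  proof -
    \<comment> \<open>A smooth branch has everything in its image, so 0 may replace c and the bound
      no longer involves it.\<close>
    interpret R: conductor_param r p "\<lambda>_. 0"
      by unfold_locales (use J that lift_if_smooth in \<open>auto simp: mt\<close>)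
    show ?thesis
      using branch_le that by (intro R.param_determined_if_cond_plus_mult_le) fastforce+
  qed
  have two: "param_determined r c p" if "mt f = 2" "r = 2"
  proof -
    \<comment> \<open>Two positive multiplicities with sum 2 are both 1, so c + m = c + 1.\<close>
    have "branch_mult 0 + branch_mult 1 = 2"
      using that by (simp add: mt numeral_2_eq_2)
    then have "branch_mult i = 1" if "i < r" for i
      using branch_mult_pos[of 0] branch_mult_pos[of 1] that \<open>r = 2\<close> by (cases "i = 0") (auto simp: less_2_cases_iff)
    then show ?thesis
      using that by (intro param_determined_if_cond_plus_mult_le) auto
  qed
  show ?thesis
    using smooth low two high[of "\<lambda>i. c i - 1"] high[of "\<lambda>i. c i + 1"] by fastforce
qed

end
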